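(* For $n\ge 1$ let $X_n$ denote the number of vertices in a uniformly random rooted map with $n$ edges (no restriction on genus). Then, as $n\to\infty$, $\mathbb{E}(X_n)\sim\log n$, $\mathbb{V}(X_n)\sim\log n$, and $$\frac{X_n-\mathbb{E}(X_n)}{\sqrt{\mathbb{V}(X_n)}}\ \overset{d}{\longrightarrow}\ \mathcal N(0,1).$$
   Context: A map is a connected multigraph (loops and multiple edges allowed) endowed with a cyclic ordering of the half-edges incident to each vertex. Around each vertex, each pair of consecutive half-edges in the cyclic order forms a corner (a vertex with only one half-edge has one corner; a vertex of degree $d\ge1$ has $d$ corners; the one-vertex map with no edge has exactly one corner). A rooted map is a map with a distinguished corner. Rooted maps are considered up to isomorphisms preserving the graph structure, the root corner and the cyclic orderings. "Random rooted map with $n$ edges" means that all rooted maps with $n$ edges are equally likely. $\mathbb{V}$ denotes variance, $\log$ is the natural logarithm, and $\overset{d}{\longrightarrow}$ is convergence in distribution. *)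

theory Defs
  imports "HOL-Probability.Probability" "HOL-Combinatorics.Orbits"
begin

text \<open>
  A multigraph is given by its vertices and half-edges, the end vertex of each half-edge, and the
  fixed-point-free involution \<open>opp\<close> whose orbits are the edges (so loops and multiple edges are
  allowed). The cyclic orderings around the vertices are given by the rotation \<open>rot\<close>.
  Values of \<open>endpt\<close>, \<open>opp\<close> and \<open>rot\<close> outside \<open>hedges\<close> are irrelevant; isomorphisms below
  ignore them.
\<close>

record ('v, 'h) emb_graph =
  verts :: "'v set"
  hedges :: "'h set"
  endpt :: "'h \<Rightarrow> 'v"
  opp :: "'h \<Rightarrow> 'h"
  rot :: "'h \<Rightarrow> 'h"

definition hedges_at :: "('v, 'h) emb_graph \<Rightarrow> 'v \<Rightarrow> 'h set" where
  "hedges_at M v = {h \<in> hedges M. endpt M h = v}"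

definition edges :: "('v, 'h) emb_graph \<Rightarrow> 'h set set" where
  "edges M = (\<lambda>h. {h, opp M h}) ` hedges M"

definition adj :: "('v, 'h) emb_graph \<Rightarrow> ('v \<times> 'v) set" where
  "adj M = (\<lambda>h. (endpt M h, endpt M (opp M h))) ` hedges M"

locale comb_map =
  fixes M :: "('v, 'h) emb_graph"
  assumes finite_verts: "finite (verts M)"
    and finite_hedges: "finite (hedges M)"
    and endpt_in: "h \<in> hedges M \<Longrightarrow> endpt M h \<in> verts M"
    and opp_in: "h \<in> hedges M \<Longrightarrow> opp M h \<in> hedges M"
    and opp_neq: "h \<in> hedges M \<Longrightarrow> opp M h \<noteq> h"
    and opp_opp: "h \<in> hedges M \<Longrightarrow> opp M (opp M h) = h"
    and cyclic_rot: "v \<in> verts M \<Longrightarrow> hedges_at M v \<noteq> {} \<Longrightarrow> cyclic_on (rot M) (hedges_at M v)"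
    and verts_nonempty: "verts M \<noteq> {}"
    and connected: "u \<in> verts M \<Longrightarrow> v \<in> verts M \<Longrightarrow> (u, v) \<in> (adj M)\<^sup>*"

text \<open>
  \<open>Between h\<close> is the corner formed by \<open>h\<close> and the next half-edge \<open>rot M h\<close>, so a vertex of degree
  \<open>d \<ge> 1\<close> has \<open>d\<close> corners; \<open>Lone v\<close> is the single corner at a vertex \<open>v\<close> without half-edges, which
  by connectedness occurs only in the map without edges.
\<close>

datatype ('v, 'h) corner = Between 'h | Lone 'v

definition corners :: "('v, 'h) emb_graph \<Rightarrow> ('v, 'h) corner set" where
  "corners M = Between ` hedges M \<union> Lone ` {v \<in> verts M. hedges_at M v = {}}"

definition map_iso ::
  "('v \<Rightarrow> 'w) \<Rightarrow> ('h \<Rightarrow> 'k) \<Rightarrow> ('v, 'h) emb_graph \<Rightarrow> ('w, 'k) emb_graph \<Rightarrow> bool" where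
  "map_iso f g M N \<longleftrightarrow>
     bij_betw f (verts M) (verts N) \<and> bij_betw g (hedges M) (hedges N) \<and>
     (\<forall>h \<in> hedges M. endpt N (g h) = f (endpt M h) \<and> opp N (g h) = g (opp M h) \<and>
        rot N (g h) = g (rot M h))"

type_synonym ('v, 'h) rooted = "('v, 'h) emb_graph \<times> ('v, 'h) corner"

text \<open>The function \<open>map_corner\<close> is the map function of the datatype \<open>corner\<close>.\<close>

definition rooted_isomorphic :: "('v, 'h) rooted \<Rightarrow> ('w, 'k) rooted \<Rightarrow> bool" where
  "rooted_isomorphic R S \<longleftrightarrow>
     (\<exists>f g. map_iso f g (fst R) (fst S) \<and> map_corner f g (snd R) = snd S)"

text \<open>
  Every finite map is isomorphic to one whose vertices and half-edges are natural numbers, so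
  labels are taken in \<open>nat\<close>.
\<close>

definition labelled_rooted_maps :: "nat \<Rightarrow> (nat, nat) rooted set" where
  "labelled_rooted_maps n = {(M, c). comb_map M \<and> card (edges M) = n \<and> c \<in> corners M}"

definition rooted_iso_rel :: "nat \<Rightarrow> ((nat, nat) rooted \<times> (nat, nat) rooted) set" where
  "rooted_iso_rel n = {(R, S). R \<in> labelled_rooted_maps n \<and> S \<in> labelled_rooted_maps n \<and>
     rooted_isomorphic R S}"

definition rooted_maps :: "nat \<Rightarrow> (nat, nat) rooted set set" where
  "rooted_maps n = labelled_rooted_maps n // rooted_iso_rel n"

text \<open>All representatives of an isomorphism class have the same number of vertices.\<close>

definition num_verts :: "(nat, nat) rooted set \<Rightarrow> nat" where
  "num_verts C = the_elem ((\<lambda>(M, c). card (verts M)) ` C)"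

definition random_rooted_map :: "nat \<Rightarrow> (nat, nat) rooted set pmf" where
  "random_rooted_map n = pmf_of_set (rooted_maps n)"

definition mean_verts :: "nat \<Rightarrow> real" where
  "mean_verts n = measure_pmf.expectation (random_rooted_map n) (\<lambda>C. real (num_verts C))"

definition var_verts :: "nat \<Rightarrow> real" where
  "var_verts n = measure_pmf.variance (random_rooted_map n) (\<lambda>C. real (num_verts C))"

subsection \<open>The uniform distribution is well defined\<close>

lemma (in comb_map) rot_in: "h \<in> hedges M \<Longrightarrow> rot M h \<in> hedges M"
proof -
  assume h: "h \<in> hedges M"
  then have "h \<in> hedges_at M (endpt M h)" by (simp add: hedges_at_def)
  moreover from this have "cyclic_on (rot M) (hedges_at M (endpt M h))"
    by (intro cyclic_rot endpt_in[OF h]) blast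
  ultimately have "rot M h \<in> hedges_at M (endpt M h)"
    by (rule cyclic_on_inI[rotated])
  then show ?thesis by (simp add: hedges_at_def)
qed

lemma map_iso_id: "map_iso id id M M"
  by (simp add: map_iso_def)

lemma map_iso_comp:
  assumes "map_iso f g M N" "map_iso f' g' N K"
  shows "map_iso (f' \<circ> f) (g' \<circ> g) M K"
proof -
  have "bij_betw (f' \<circ> f) (verts M) (verts K)" "bij_betw (g' \<circ> g) (hedges M) (hedges K)"
    using assms bij_betw_trans unfolding map_iso_def by metis+
  moreover have "g h \<in> hedges N" if "h \<in> hedges M" for h
    using assms(1) that by (auto simp: map_iso_def bij_betw_def)
  ultimately show ?thesis
    using assms by (simp add: map_iso_def)
qed

lemma map_iso_inv:
  assumes M: "comb_map M" and iso: "map_iso f g M N"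
  shows "map_iso (inv_into (verts M) f) (inv_into (hedges M) g) N M"
proof -
  interpret comb_map M by fact
  have f: "bij_betw f (verts M) (verts N)" and g: "bij_betw g (hedges M) (hedges N)"
    using iso by (auto simp: map_iso_def)
  have "endpt M (inv_into (hedges M) g k) = inv_into (verts M) f (endpt N k) \<and>
      opp M (inv_into (hedges M) g k) = inv_into (hedges M) g (opp N k) \<and>
      rot M (inv_into (hedges M) g k) = inv_into (hedges M) g (rot N k)"
    if k: "k \<in> hedges N" for k
  proof -
    obtain h where h: "h \<in> hedges M" "k = g h"
      using g k by (auto simp: bij_betw_def)
    show ?thesis
      using h iso endpt_in[OF h(1)] opp_in[OF h(1)] rot_in[OF h(1)]
        bij_betw_inv_into_left[OF f] bij_betw_inv_into_left[OF g]
      by (simp add: map_iso_def)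
  qed
  then show ?thesis
    using bij_betw_inv_into[OF f] bij_betw_inv_into[OF g] by (simp add: map_iso_def)
qed

lemma map_iso_hedges_at:
  assumes M: "comb_map M" and iso: "map_iso f g M N" and v: "v \<in> verts M"
  shows "hedges_at N (f v) = g ` hedges_at M v"
proof -
  interpret comb_map M by fact
  have inj: "inj_on f (verts M)" and g: "hedges N = g ` hedges M"
    using iso by (auto simp: map_iso_def bij_betw_def)
  show ?thesis
    using iso v endpt_in by (auto simp: hedges_at_def g map_iso_def inj_on_eq_iff[OF inj])
qed

lemma map_iso_corners:
  assumes M: "comb_map M" and iso: "map_iso f g M N"
  shows "corners N = map_corner f g ` corners M"
proof -
  have "verts N = f ` verts M" "hedges N = g ` hedges M"
    using iso by (auto simp: map_iso_def bij_betw_def)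
  then show ?thesis
    using map_iso_hedges_at[OF M iso] by (auto simp: corners_def image_Un image_image)
qed

lemma map_iso_card_edges:
  assumes M: "comb_map M" and iso: "map_iso f g M N"
  shows "card (edges N) = card (edges M)"
proof -
  interpret comb_map M by fact
  have g: "hedges N = g ` hedges M" "inj_on g (hedges M)"
    using iso by (auto simp: map_iso_def bij_betw_def)
  have "edges N = (`) g ` edges M"
    using iso unfolding edges_def g(1) image_image by (intro image_cong) (auto simp: map_iso_def)
  moreover have "edges M \<subseteq> Pow (hedges M)"
    using opp_in by (auto simp: edges_def)
  then have "inj_on ((`) g) (edges M)"
    using inj_on_image_Pow[OF g(2)] inj_on_subset by blast
  ultimately show ?thesis by (simp add: card_image)
qed

lemma map_iso_comb_map:
  assumes M: "comb_map M" and iso: "map_iso f g M N"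
  shows "comb_map N"
proof -
  interpret comb_map M by fact
  have V: "verts N = f ` verts M" and H: "hedges N = g ` hedges M"
    and inj: "inj_on g (hedges M)"
    using iso by (auto simp: map_iso_def bij_betw_def)
  have c: "endpt N (g h) = f (endpt M h)" "opp N (g h) = g (opp M h)" "rot N (g h) = g (rot M h)"
    if "h \<in> hedges M" for h
    using iso that by (auto simp: map_iso_def)
  show ?thesis
  proof
    show "finite (verts N)" "finite (hedges N)" "verts N \<noteq> {}"
      using finite_verts finite_hedges verts_nonempty by (auto simp: V H)
    show "endpt N h \<in> verts N" "opp N h \<in> hedges N" "opp N h \<noteq> h" "opp N (opp N h) = h"
      if "h \<in> hedges N" for h
      using that opp_in opp_neq endpt_in opp_opp by (auto simp: H V c inj_on_eq_iff[OF inj])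
    show "cyclic_on (rot N) (hedges_at N v)" if v: "v \<in> verts N" and ne: "hedges_at N v \<noteq> {}" for v
    proof -
      obtain u where u: "u \<in> verts M" "v = f u" using v V by auto
      have eq: "hedges_at N v = g ` hedges_at M u"
        using map_iso_hedges_at[OF M iso u(1)] u(2) by simp
      have "cyclic_on (rot M) (hedges_at M u)"
        using cyclic_rot u(1) ne eq by auto
      then show ?thesis
        unfolding eq by (rule cyclic_on_image) (simp add: c hedges_at_def)
    qed
    show "(u, v) \<in> (adj N)\<^sup>*" if uv: "u \<in> verts N" "v \<in> verts N" for u v
    proof -
      have step: "(f a, f b) \<in> adj N" if ab: "(a, b) \<in> adj M" for a b
      proof -
        obtain h where h: "h \<in> hedges M" "a = endpt M h" "b = endpt M (opp M h)"
          using ab unfolding adj_def by blast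
        then have "(f a, f b) = (endpt N (g h), endpt N (opp N (g h)))" "g h \<in> hedges N"
          using opp_in by (auto simp: c H)
        then show ?thesis unfolding adj_def by blast
      qed
      have "(f a, f b) \<in> (adj N)\<^sup>*" if "(a, b) \<in> (adj M)\<^sup>*" for a b
        using that by induction (auto intro: rtrancl_into_rtrancl step)
      then show ?thesis using uv connected by (auto simp: V)
    qed
  qed
qed

lemma equiv_rooted_iso_rel: "equiv (labelled_rooted_maps n) (rooted_iso_rel n)"
proof (rule equivI)
  show "rooted_iso_rel n \<subseteq> labelled_rooted_maps n \<times> labelled_rooted_maps n"
    by (auto simp: rooted_iso_rel_def)
  show "refl_on (labelled_rooted_maps n) (rooted_iso_rel n)"
    by (rule refl_onI)
      (auto simp: rooted_iso_rel_def rooted_isomorphic_def corner.map_id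
        intro!: exI[where x = id] map_iso_id)
  show "sym (rooted_iso_rel n)"
  proof (rule symI)
    fix R S assume RS: "(R, S) \<in> rooted_iso_rel n"
    obtain M c where R: "R = (M, c)" "comb_map M" "c \<in> corners M"
      using RS by (cases R) (auto simp: rooted_iso_rel_def labelled_rooted_maps_def)
    obtain f g where fg: "map_iso f g M (fst S)" "map_corner f g c = snd S"
      using RS R by (auto simp: rooted_iso_rel_def rooted_isomorphic_def)
    have inj: "inj_on f (verts M)" "inj_on g (hedges M)"
      using fg(1) by (auto simp: map_iso_def bij_betw_def)
    have "map_corner (inv_into (verts M) f) (inv_into (hedges M) g) (snd S) = c"
      unfolding fg(2)[symmetric] using R(3) inj by (auto simp: corners_def)
    then have "rooted_isomorphic S R"
      unfolding rooted_isomorphic_def using map_iso_inv[OF R(2) fg(1)] R(1) by auto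
    then show "(S, R) \<in> rooted_iso_rel n"
      using RS by (auto simp: rooted_iso_rel_def)
  qed
  show "trans (rooted_iso_rel n)"
  proof (rule transI)
    fix R S T assume RST: "(R, S) \<in> rooted_iso_rel n" "(S, T) \<in> rooted_iso_rel n"
    obtain f g where fg: "map_iso f g (fst R) (fst S)" "map_corner f g (snd R) = snd S"
      using RST(1) by (auto simp: rooted_iso_rel_def rooted_isomorphic_def)
    obtain f' g' where fg': "map_iso f' g' (fst S) (fst T)" "map_corner f' g' (snd S) = snd T"
      using RST(2) by (auto simp: rooted_iso_rel_def rooted_isomorphic_def)
    have "map_corner (f' \<circ> f) (g' \<circ> g) (snd R) = snd T"
      using fg(2) fg'(2) by (metis corner.map_comp)
    then have "rooted_isomorphic R T"
      unfolding rooted_isomorphic_def using map_iso_comp[OF fg(1) fg'(1)] by blast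
    then show "(R, T) \<in> rooted_iso_rel n"
      using RST by (auto simp: rooted_iso_rel_def)
  qed
qed

lemma num_verts_class:
  assumes "C \<in> rooted_maps n" "(M, c) \<in> C"
  shows "num_verts C = card (verts M)"
proof -
  have "card (verts (fst R)) = card (verts M)" if "R \<in> C" for R
  proof -
    have "(R, (M, c)) \<in> rooted_iso_rel n"
      using quotient_eq_iff[OF equiv_rooted_iso_rel assms(1)[unfolded rooted_maps_def]
          assms(1)[unfolded rooted_maps_def] that assms(2)] by blast
    then obtain f where "bij_betw f (verts (fst R)) (verts M)"
      by (auto simp: rooted_iso_rel_def rooted_isomorphic_def map_iso_def)
    then show ?thesis by (rule bij_betw_same_card)
  qed
  then have "(\<lambda>R. card (verts (fst R))) ` C = (\<lambda>R. card (verts M)) ` C"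
    by (rule image_cong[OF refl])
  also have "\<dots> = {card (verts M)}"
    using assms(2) by (simp add: image_constant)
  finally have "(\<lambda>(M, c). card (verts M)) ` C = {card (verts M)}"
    by (simp only: case_prod_unfold)
  then show ?thesis by (simp add: num_verts_def)
qed

lemma (in comb_map) card_hedges_le: "card (hedges M) \<le> 2 * card (edges M)"
proof -
  have "card (\<Union> (edges M)) \<le> (\<Sum>e\<in>edges M. card e)"
    by (rule card_Union_le_sum_card)
  also have "\<dots> \<le> (\<Sum>e\<in>edges M. 2)"
    by (rule sum_mono) (auto simp: edges_def card_insert_if)
  also have "\<dots> = 2 * card (edges M)" by simp
  finally have "card (\<Union> (edges M)) \<le> 2 * card (edges M)" .
  moreover have "hedges M \<subseteq> \<Union> (edges M)" "finite (\<Union> (edges M))"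
    using finite_hedges by (auto simp: edges_def)
  ultimately show ?thesis
    by (meson card_mono order_trans)
qed

lemma (in comb_map) card_verts_le: "card (verts M) \<le> Suc (card (hedges M))"
proof (cases "verts M \<subseteq> endpt M ` hedges M")
  case True
  then have "card (verts M) \<le> card (endpt M ` hedges M)"
    using finite_hedges by (intro card_mono) auto
  then show ?thesis
    using card_image_le[OF finite_hedges, of "endpt M"] by simp
next
  case False
  then obtain v where v: "v \<in> verts M" "v \<notin> endpt M ` hedges M" by auto
  have "u = v" if "u \<in> verts M" for u
    using connected[OF v(1) that]
    by (cases rule: converse_rtranclE) (use v(2) in \<open>auto simp: adj_def\<close>)
  then have "verts M = {v}" using v by blast
  then show ?thesis by simp
qed

lemma finite_rooted_maps: "finite (rooted_maps n)"
proof -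
  define B where "B = {..2 * n}"
  define P where "P = (PiE B (\<lambda>_. B))"
  define F :: "(nat, nat) rooted set" where
    "F = (\<lambda>(V, H, e, p, x, c). (\<lparr>verts = V, hedges = H, endpt = e, opp = p, rot = x\<rparr>, c)) `
       (Pow B \<times> Pow B \<times> P \<times> P \<times> P \<times> (Between ` B \<union> Lone ` B))"
  have "finite B" by (simp add: B_def)
  then have "finite F" by (simp add: F_def P_def finite_PiE)
  have "rooted_maps n \<subseteq> (\<lambda>R. rooted_iso_rel n `` {R}) ` F"
  proof
    fix C assume "C \<in> rooted_maps n"
    then obtain R where R: "R \<in> labelled_rooted_maps n" and C: "C = rooted_iso_rel n `` {R}"
      by (auto simp: rooted_maps_def elim: quotientE)
    obtain M c where Mc: "R = (M, c)" "comb_map M" "card (edges M) = n" "c \<in> corners M"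
      using R by (cases R) (auto simp: labelled_rooted_maps_def)
    interpret comb_map M by fact
    have cH: "card (hedges M) \<le> card B"
      using card_hedges_le Mc(3) by (simp add: B_def)
    have cV: "card (verts M) \<le> card B"
      using card_verts_le card_hedges_le Mc(3) by (simp add: B_def)
    obtain f where f: "f ` verts M \<subseteq> B" "inj_on f (verts M)"
      using card_le_inj[OF finite_verts \<open>finite B\<close> cV] by auto
    obtain g where g: "g ` hedges M \<subseteq> B" "inj_on g (hedges M)"
      using card_le_inj[OF finite_hedges \<open>finite B\<close> cH] by auto
    define ext :: "(nat \<Rightarrow> nat) \<Rightarrow> nat \<Rightarrow> nat" where
      "ext = (\<lambda>q. restrict (\<lambda>k. if k \<in> g ` hedges M then q (inv_into (hedges M) g k) else 0) B)"
    have ext_P: "ext q \<in> P" if "\<And>h. h \<in> hedges M \<Longrightarrow> q h \<in> B" for q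
      using that g(2) by (auto simp: ext_def P_def B_def)
    have ext_g: "ext q (g h) = q h" if "h \<in> hedges M" for q h
      using that g by (auto simp: ext_def)
    define N where "N = \<lparr>verts = f ` verts M, hedges = g ` hedges M, endpt = ext (f \<circ> endpt M),
      opp = ext (g \<circ> opp M), rot = ext (g \<circ> rot M)\<rparr>"
    have iso: "map_iso f g M N"
      using f(2) g(2) by (auto simp: map_iso_def N_def ext_g intro: inj_on_imp_bij_betw)
    define S where "S = (N, map_corner f g c)"
    have "S \<in> labelled_rooted_maps n"
      using map_iso_comb_map[OF Mc(2) iso] map_iso_card_edges[OF Mc(2) iso]
        map_iso_corners[OF Mc(2) iso] Mc by (auto simp: S_def labelled_rooted_maps_def)
    then have "(R, S) \<in> rooted_iso_rel n"
      using R iso by (auto simp: rooted_iso_rel_def rooted_isomorphic_def S_def Mc(1))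
    then have CS: "C = rooted_iso_rel n `` {S}"
      unfolding C by (rule equiv_class_eq[OF equiv_rooted_iso_rel])
    have "map_corner f g c \<in> Between ` B \<union> Lone ` B"
      using Mc(4) f(1) g(1) by (auto simp: corners_def)
    moreover have "ext (f \<circ> endpt M) \<in> P" "ext (g \<circ> opp M) \<in> P" "ext (g \<circ> rot M) \<in> P"
      using f(1) g(1) endpt_in opp_in rot_in by (auto intro!: ext_P)
    ultimately have "S \<in> F"
      unfolding F_def using f(1) g(1)
      by (intro image_eqI[where x = "(f ` verts M, g ` hedges M, ext (f \<circ> endpt M),
            ext (g \<circ> opp M), ext (g \<circ> rot M), map_corner f g c)"])
        (simp_all add: S_def N_def)
    with CS show "C \<in> (\<lambda>R. rooted_iso_rel n `` {R}) ` F" by (rule image_eqI)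
  qed
  then show ?thesis
    by (rule finite_surj[OF \<open>finite F\<close>])
qed

lemma rooted_maps_nonempty: "rooted_maps n \<noteq> {}"
proof -
  define s where "s = (\<lambda>h. if Suc h = 2 * n then 0 else Suc h)"
  define p where "p = (\<lambda>h::nat. if even h then h + 1 else h - 1)"
  define M :: "(nat, nat) emb_graph" where
    "M = \<lparr>verts = {0}, hedges = {..<2 * n}, endpt = (\<lambda>_. 0), opp = p, rot = s\<rparr>"
  have orb: "h \<in> orbit s 0" if "0 < h" "h < 2 * n" for h
    using that
  proof (induction h)
    case (Suc h)
    have s: "s h = Suc h" using Suc.prems by (simp add: s_def)
    have "s h \<in> orbit s 0"
    proof (cases "h = 0")
      case True
      then show ?thesis using orbit.base[of s 0] by simp
    next
      case False
      then have "h \<in> orbit s 0" using Suc.IH Suc.prems by simp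
      then show ?thesis by (rule orbit.step)
    qed
    then show ?case by (simp only: s)
  qed simp
  have cyc: "cyclic_on s {..<2 * n}" if "n > 0"
  proof -
    have "2 * n - 1 \<in> orbit s 0" using orb[of "2 * n - 1"] that by simp
    then have "s (2 * n - 1) \<in> orbit s 0" by (rule orbit.step)
    then have "0 \<in> orbit s 0" using that by (simp add: s_def)
    then have "{..<2 * n} \<subseteq> orbit s 0" using orb by (auto simp: subset_iff) (metis neq0_conv)
    moreover have "x < 2 * n" if "x \<in> orbit s 0" for x
      using that by induction (use \<open>n > 0\<close> in \<open>auto simp: s_def\<close>)
    ultimately show ?thesis using that by (auto simp: cyclic_on_def)
  qed
  have p: "p h < 2 * n" "p h \<noteq> h" "p (p h) = h" if "h < 2 * n" for h
    using that by (auto simp: p_def elim!: oddE evenE)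
  have "comb_map M"
  proof
    show "cyclic_on (rot M) (hedges_at M v)" if "v \<in> verts M" "hedges_at M v \<noteq> {}" for v
    proof -
      have "hedges_at M v = {..<2 * n}" using that by (auto simp: M_def hedges_at_def)
      then show ?thesis using that cyc by (cases "n = 0") (auto simp: M_def)
    qed
  qed (auto simp: M_def p)
  moreover have "card (edges M) = n"
  proof -
    have "edges M = (\<lambda>i. {2 * i, 2 * i + 1}) ` {..<n}"
    proof (intro equalityI subsetI)
      fix e assume "e \<in> edges M"
      then obtain h where h: "h < 2 * n" "e = {h, p h}" by (auto simp: edges_def M_def)
      then have "e = {2 * (h div 2), 2 * (h div 2) + 1}" "h div 2 < n"
        by (auto simp: p_def elim!: oddE)
      then show "e \<in> (\<lambda>i. {2 * i, 2 * i + 1}) ` {..<n}" by blast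
    next
      fix e assume "e \<in> (\<lambda>i. {2 * i, 2 * i + 1}) ` {..<n}"
      then obtain i where "i < n" "e = {2 * i, p (2 * i)}" by (auto simp: p_def)
      then show "e \<in> edges M" by (auto simp: edges_def M_def)
    qed
    moreover have "inj_on (\<lambda>i::nat. {2 * i, 2 * i + 1}) {..<n}"
      by (rule inj_onI) (auto simp: doubleton_eq_iff)
    ultimately show ?thesis by (simp add: card_image)
  qed
  moreover have "(if n = 0 then Lone 0 else Between 0) \<in> corners M"
    by (auto simp: corners_def M_def hedges_at_def)
  ultimately have "(M, if n = 0 then Lone 0 else Between 0) \<in> labelled_rooted_maps n"
    by (auto simp: labelled_rooted_maps_def)
  then show ?thesis by (auto simp: rooted_maps_def quotient_def)
qed

lemma random_rooted_map_uniform: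
  "set_pmf (random_rooted_map n) = rooted_maps n"
  "C \<in> rooted_maps n \<Longrightarrow> pmf (random_rooted_map n) C = 1 / real (card (rooted_maps n))"
  by (auto simp: random_rooted_map_def finite_rooted_maps rooted_maps_nonempty)

end

theory Submission
  imports Defs "HOL-Real_Asymp.Real_Asymp"
begin

text \<open>
  Fix the edges by pairing the half-edges \<open>2 i\<close> and \<open>2 i + 1\<close>, so that a rooted map with \<open>n\<close>
  edges is given by a permutation of \<open>2 n\<close> half-edges that acts transitively together with the
  pairing. Rooted maps have no nontrivial automorphisms, hence every rooted map arises from equally
  many such permutations, and its vertices are the cycles. A uniform permutation of \<open>2 n\<close> points
  fails to be transitive with probability at most \<open>\<Sum>k. (n choose k) / (2 n choose 2 k) = O(1 / n)\<close>,
  so the number of vertices is within total variation distance \<open>O(1 / n)\<close> of the number of cycles of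
  a uniform permutation, a sum of independent Bernoulli variables with parameters \<open>1 / j\<close>,
  \<open>j \<le> 2 n\<close>. Moments transfer because the fourth central moment of that sum is \<open>O(log\<^sup>2 n)\<close>, and the limit
  law follows from Levy's continuity theorem.
\<close>

subsection \<open>Cycles of a uniform permutation\<close>

text \<open>The number of values depends only on how \<open>S\<close> is partitioned into fibres.
  Orbits of different permutations can thus be counted alike without an explicit bijection between
  the orbits.\<close>

lemma card_image_eq_kernel:
  assumes "\<And>x y. x \<in> S \<Longrightarrow> y \<in> S \<Longrightarrow> f x = f y \<longleftrightarrow> g x = g y"
  shows "card (f ` S) = card (g ` S)"
proof -
  have "inj_on (\<lambda>A. g (inv_into S f A)) (f ` S)"
    by (rule inj_onI) (metis assms f_inv_into_f inv_into_into)
  moreover have "(\<lambda>A. g (inv_into S f A)) ` (f ` S) = g ` S"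
    unfolding image_image
    by (rule image_cong[OF refl]) (metis assms f_inv_into_f imageI inv_into_into)
  ultimately show ?thesis by (metis card_image)
qed

lemma permutes_orbit_eq_iff:
  assumes "finite S" "p permutes S"
  shows "orbit p x = orbit p y \<longleftrightarrow> y \<in> orbit p x"
proof -
  have p: "permutation p" using assms permutation_permutes by blast
  have "orbit p y = orbit p x" if "y \<in> orbit p x"
    by (rule orbit_cyclic_eq3[OF cyclic_on_orbit'[OF p] that])
  then show ?thesis using permutation_self_in_orbit[OF p] by blast
qed

text \<open>A fixed point has a singleton orbit and so counts as a cycle.\<close>

definition num_cycles :: "'a set \<Rightarrow> ('a \<Rightarrow> 'a) \<Rightarrow> nat" where
  "num_cycles S p = card (orbit p ` S)"

text \<open>Composing with the transposition inserts \<open>a\<close> into the cycle of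
  \<open>b\<close>, immediately before \<open>b\<close>; seen from \<open>S\<close>, the cycles stay
  the same.\<close>

lemma orbit_transpose_insert_iff:
  assumes p: "p permutes S" and a: "a \<notin> S" and b: "b \<in> S" and x: "x \<in> S" and y: "y \<in> S"
  shows "y \<in> orbit (Transposition.transpose a b \<circ> p) x \<longleftrightarrow> y \<in> orbit p x"
proof
  let ?q = "Transposition.transpose a b \<circ> p"
  have pa: "p a = a" using p a by (simp add: permutes_def)
  have pS: "p z \<noteq> a" if "z \<in> S" for z using p that a by (metis permutes_in_image)
  \<comment> \<open>A path of the new permutation may pass through \<open>a\<close>, which lies
    outside \<open>S\<close>; what is carried along there is that its successor \<open>b\<close>
    belongs to the old orbit.\<close>
  have "(y \<noteq> a \<longrightarrow> y \<in> orbit p x \<and> y \<in> S) \<and> (y = a \<longrightarrow> b \<in> orbit p x)"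
    if "y \<in> orbit ?q x" for y
    using that
  proof induction
    case base
    have "p x \<in> orbit p x" by (rule orbit.base)
    then show ?case using pS[OF x] a b permutes_in_image[OF p] x
      by (auto simp: Transposition.transpose_def)
  next
    case (step z)
    show ?case
    proof (cases "z = a")
      case True
      then show ?thesis using step a b by (auto simp: pa)
    next
      case False
      then have "z \<in> orbit p x" "z \<in> S" using step by auto
      then have "p z \<in> orbit p x" "p z \<in> S" using permutes_in_image[OF p] by (auto intro: orbit.step)
      then show ?thesis using a b by (auto simp: Transposition.transpose_def)
    qed
  qed
  then show "y \<in> orbit ?q x \<Longrightarrow> y \<in> orbit p x" using y a by blast
  \<comment> \<open>One step of \<open>p\<close> is one step of the new permutation, or two steps by
    way of \<open>a\<close> when \<open>p z = b\<close>.\<close>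
  have step: "p z \<in> orbit ?q x" if "?q z \<in> orbit ?q x" "z \<in> S" for z
  proof (cases "p z = b")
    case True
    then have "a \<in> orbit ?q x" using that by simp
    then have "?q a \<in> orbit ?q x" by (rule orbit.step)
    then show ?thesis using True by (simp add: pa)
  next
    case False
    then show ?thesis using that pS[of z] by simp
  qed
  have "y \<in> S \<and> y \<in> orbit ?q x" if "y \<in> orbit p x"
    using that
    by induction (auto intro!: step x orbit.intros simp: permutes_in_image[OF p] simp del: comp_apply)
  then show "y \<in> orbit p x \<Longrightarrow> y \<in> orbit ?q x" by blast
qed

lemma num_cycles_transpose_insert:
  assumes S: "finite S" and p: "p permutes S" and a: "a \<notin> S" and b: "b \<in> S"
  shows "num_cycles (insert a S) (Transposition.transpose a b \<circ> p) = num_cycles S p"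
proof -
  let ?q = "Transposition.transpose a b \<circ> p"
  have q: "?q permutes insert a S"
    using b permutes_compose[OF permutes_subset[OF p] permutes_swap_id, of "insert a S" a b] by auto
  note orbit_q = permutes_orbit_eq_iff[OF _ q] and orbit_p = permutes_orbit_eq_iff[OF S p]
  have "?q a = b" using p a by (simp add: permutes_def)
  then have "orbit ?q a = orbit ?q b"
    using S orbit.base[of ?q a] by (subst orbit_q) auto
  then have "orbit ?q ` insert a S = orbit ?q ` S" using b by auto
  moreover have "card (orbit ?q ` S) = card (orbit p ` S)"
    by (rule card_image_eq_kernel)
      (use S in \<open>simp add: orbit_q orbit_p orbit_transpose_insert_iff[OF p a b]\<close>)
  ultimately show ?thesis by (simp add: num_cycles_def)
qed

lemma num_cycles_insert_fixed:
  assumes S: "finite S" and p: "p permutes S" and a: "a \<notin> S"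
  shows "num_cycles (insert a S) p = Suc (num_cycles S p)"
proof -
  have "orbit p a = {a}" using p a by (simp add: orbit_eq_singleton_iff permutes_def)
  moreover have "a \<notin> orbit p x" if "x \<in> S" for x
    using permutes_orbit_subset[OF p that] a by blast
  ultimately have "orbit p a \<notin> orbit p ` S" by (metis image_iff singletonI)
  then show ?thesis using S by (simp add: num_cycles_def)
qed

text \<open>The expectation under a uniform permutation, as a finite sum. The value type is general
  because both real moments and complex characteristic functions are needed.\<close>

definition cycle_mean :: "nat \<Rightarrow> (nat \<Rightarrow> 'a::real_normed_field) \<Rightarrow> 'a" where
  "cycle_mean N f = (\<Sum>p | p permutes {..<N}. f (num_cycles {..<N} p)) / fact N"

lemma cycle_mean_0: "cycle_mean 0 f = f 0"
  by (simp add: cycle_mean_def num_cycles_def permutes_empty cong: conj_cong)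

text \<open>Every permutation of \<open>N + 1\<close> points is uniquely a transposition of
  \<open>N\<close> and some \<open>b\<close> after a permutation of the first \<open>N\<close>
  points. The choice \<open>b = N\<close> opens a new cycle; each of the other \<open>N\<close>
  choices leaves the number of cycles unchanged.\<close>

lemma cycle_mean_Suc:
  "cycle_mean (Suc N) f = (cycle_mean N (\<lambda>k. f (Suc k)) + of_nat N * cycle_mean N f) / of_nat (Suc N)"
proof -
  have "(\<Sum>p | p permutes {..<Suc N}. f (num_cycles {..<Suc N} p)) =
      (\<Sum>b\<in>insert N {..<N}. \<Sum>q | q permutes {..<N}.
        f (num_cycles (insert N {..<N}) (Transposition.transpose N b \<circ> q)))"
    unfolding lessThan_Suc by (rule sum_over_permutations_insert) auto
  also have "\<dots> = (\<Sum>q | q permutes {..<N}. f (Suc (num_cycles {..<N} q))) +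
      (\<Sum>b<N. \<Sum>q | q permutes {..<N}. f (num_cycles {..<N} q))"
    by (simp add: num_cycles_transpose_insert num_cycles_insert_fixed)
  finally show ?thesis
    by (simp add: cycle_mean_def add_divide_distrib mult.commute del: of_nat_Suc)
qed

lemma cycle_mean_add: "cycle_mean N (\<lambda>k. f k + g k) = cycle_mean N f + cycle_mean N g"
  by (simp add: cycle_mean_def sum.distrib add_divide_distrib)

lemma cycle_mean_cmult: "cycle_mean N (\<lambda>k. c * f k) = c * cycle_mean N f"
  by (simp add: cycle_mean_def sum_distrib_left)

lemma cycle_mean_const: "cycle_mean N (\<lambda>k. c) = c"
  by (simp add: cycle_mean_def card_permutations[of _ N])

text \<open>The factor for \<open>j\<close> is the probability generating function of a Bernoulli
  variable with parameter \<open>1 / j\<close>, so in law the number of cycles is a sum of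
  independent such variables.\<close>

lemma cycle_mean_power:
  fixes z :: "'a::real_normed_field"
  shows "cycle_mean N (\<lambda>k. z ^ k) = (\<Prod>j=1..N. 1 + (z - 1) / of_nat j)"
proof (induction N)
  case (Suc N)
  have N: "of_nat (Suc N) \<noteq> (0 :: 'a)" by (rule of_nat_neq_0)
  have "cycle_mean (Suc N) (\<lambda>k. z ^ k) = (z + of_nat N) * cycle_mean N (\<lambda>k. z ^ k) / of_nat (Suc N)"
    by (simp only: cycle_mean_Suc power_Suc cycle_mean_cmult distrib_right)
  also have "\<dots> = cycle_mean N (\<lambda>k. z ^ k) * ((z + of_nat N) / of_nat (Suc N))"
    by (simp only: times_divide_eq_right mult.commute[of "z + of_nat N"])
  also have "(z + of_nat N) / of_nat (Suc N) = 1 + (z - 1) / of_nat (Suc N)"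
  proof -
    have "z + of_nat N = of_nat (Suc N) + (z - 1)" by simp
    then show ?thesis by (simp only: add_divide_distrib divide_self[OF N])
  qed
  finally show ?case using Suc by (simp del: of_nat_Suc)
qed (simp add: cycle_mean_0)

section \<open>Central moments of the number of cycles\<close>

lemma cycle_mean_centred_Suc:
  fixes g :: "real \<Rightarrow> real" and N :: nat
  defines "p \<equiv> 1 / real (Suc N)"
  shows "cycle_mean (Suc N) (\<lambda>k. g (real k - harm (Suc N))) =
    p * cycle_mean N (\<lambda>k. g (real k - harm N + (1 - p))) +
    (1 - p) * cycle_mean N (\<lambda>k. g (real k - harm N + - p))"
proof -
  \<comment> \<open>\<open>p\<close> is the probability that the new point opens a cycle. The
    centring moves by \<open>p\<close> as well, so the deviation changes by \<open>1 - p\<close> or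
    by \<open>- p\<close>.\<close>
  have h: "harm (Suc N) = harm N + p" by (simp add: harm_Suc p_def field_simps)
  have p: "1 - p = real N / real (Suc N)" by (simp add: p_def field_simps)
  have 1: "real (Suc k) - harm (Suc N) = real k - harm N + (1 - p)"
    and 2: "real k - harm (Suc N) = real k - harm N + - p" for k
    unfolding h by simp_all
  have 3: "(a + real N * b) / real (Suc N) = p * a + (1 - p) * b" for a b
    unfolding p by (simp add: p_def add_divide_distrib)
  show ?thesis
    unfolding cycle_mean_Suc 1 3 unfolding 2 ..
qed

text \<open>The two increments average to \<open>p * (1 - p) - (1 - p) * p = 0\<close>; hence
  \<open>harm N\<close> is the mean number of cycles.\<close>

lemma cycle_mean_centred: "cycle_mean N (\<lambda>k. real k - harm N) = 0"
proof (induction N)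
  case (Suc N)
  define p :: real where "p = 1 / real (Suc N)"
  have "cycle_mean N (\<lambda>k. real k - harm N + c) = c" for c
    by (simp only: cycle_mean_add cycle_mean_const Suc add_0)
  then show ?case
    unfolding cycle_mean_centred_Suc[of N "\<lambda>x. x", folded p_def]
    by (simp only:) (simp add: algebra_simps)
qed (simp add: cycle_mean_0 harm_def)

text \<open>The cross term vanishes by \<open>cycle_mean_centred\<close>, which leaves the variance
  \<open>p * (1 - p)\<close> of the new Bernoulli variable.\<close>

lemma cycle_mean_square_Suc:
  fixes N :: nat
  defines "p \<equiv> 1 / real (Suc N)"
  shows "cycle_mean (Suc N) (\<lambda>k. (real k - harm (Suc N)) ^ 2) =
    cycle_mean N (\<lambda>k. (real k - harm N) ^ 2) + p * (1 - p)"
proof -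
  have "cycle_mean N (\<lambda>k. (real k - harm N + c) ^ 2) =
      cycle_mean N (\<lambda>k. (real k - harm N) ^ 2) + c ^ 2" for c
  proof -
    have "(x + c) ^ 2 = x ^ 2 + (2 * c * x + c ^ 2)" for x :: real
      by (simp add: power2_eq_square algebra_simps)
    then show ?thesis
      by (simp only: cycle_mean_add cycle_mean_cmult cycle_mean_const cycle_mean_centred)
  qed
  then show ?thesis
    unfolding cycle_mean_centred_Suc[of N "\<lambda>x. x ^ 2", folded p_def]
    by (simp only:) (simp add: algebra_simps power2_eq_square)
qed

text \<open>In the binomial expansion the third moment cancels because the increment has mean zero,
  and the first moment is zero itself. What remains is the second moment times six Bernoulli
  variances and a fourth Bernoulli moment.\<close>

lemma cycle_mean_fourth_power_Suc:
  fixes N :: nat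
  defines "p \<equiv> 1 / real (Suc N)"
  shows "cycle_mean (Suc N) (\<lambda>k. (real k - harm (Suc N)) ^ 4) \<le>
    cycle_mean N (\<lambda>k. (real k - harm N) ^ 4) + 6 * p * cycle_mean N (\<lambda>k. (real k - harm N) ^ 2) + p"
proof -
  have p: "0 \<le> p" "p \<le> 1" by (simp_all add: p_def)
  let ?Y = "\<lambda>k. real k - harm N"
  define m where "m j = cycle_mean N (\<lambda>k. ?Y k ^ j)" for j
  have "m 2 \<ge> 0" unfolding m_def cycle_mean_def by (intro divide_nonneg_nonneg sum_nonneg) auto
  have E: "cycle_mean N (\<lambda>k. (real k - harm N + c) ^ 4) = m 4 + 4 * c * m 3 + 6 * c ^ 2 * m 2 + c ^ 4" for c
  proof -
    have "(x + c) ^ 4 = x ^ 4 + 4 * c * x ^ 3 + 6 * c ^ 2 * x ^ 2 + (4 * c ^ 3 * x + c ^ 4)" for x :: real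
      by (simp add: eval_nat_numeral algebra_simps)
    then show ?thesis unfolding m_def
      by (simp only: cycle_mean_add cycle_mean_cmult cycle_mean_const cycle_mean_centred)
  qed
  have "cycle_mean (Suc N) (\<lambda>k. (real k - harm (Suc N)) ^ 4) =
      m 4 + 6 * (p * (1 - p)) * m 2 + (p * (1 - p) ^ 4 + (1 - p) * p ^ 4)"
    unfolding cycle_mean_centred_Suc[of N "\<lambda>x. x ^ 4", folded p_def] E
    by (simp add: eval_nat_numeral algebra_simps)
  also have "\<dots> \<le> m 4 + 6 * p * m 2 + p"
  proof -
    have "p * (1 - p) \<le> p" using p by (simp add: mult_left_le)
    then have "p * (1 - p) * m 2 \<le> p * m 2" using \<open>m 2 \<ge> 0\<close> by (rule mult_right_mono)
    \<comment> \<open>This bound and the next one, \<open>p ^ 2\<close>, add up to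
      \<open>p\<close>.\<close>
    moreover have "p * (1 - p) ^ 4 \<le> p * (1 - p)"
      using p power_decreasing[of 1 4 "1 - p"] by (intro mult_left_mono) auto
    moreover have "(1 - p) * p ^ 4 \<le> 1 * p ^ 2"
      using p power_decreasing[of 2 4 p] by (intro mult_mono) auto
    ultimately show ?thesis by (simp add: power2_eq_square algebra_simps)
  qed
  finally show ?thesis by (simp add: m_def)
qed

text \<open>Telescoping: an inverse square is at most the difference of two consecutive reciprocals.
  The induction carries the sharper bound with the last reciprocal subtracted.\<close>

lemma sum_inverse_squares_le: "(\<Sum>j<N. 1 / real (Suc j) ^ 2) \<le> 2"
proof -
  have "(\<Sum>j<Suc n. 1 / real (Suc j) ^ 2) \<le> 2 - 1 / real (Suc n)" for n
  proof (induction n)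
    case (Suc n)
    have "1 / real (Suc (Suc n)) ^ 2 \<le> 1 / real (Suc n) - 1 / real (Suc (Suc n))"
      by (simp add: divide_simps power2_eq_square)
    then show ?case using Suc by simp
  qed simp
  from this[of "N - 1"] show ?thesis
    by (cases N) (auto intro: order_trans)
qed

text \<open>The Bernoulli variances \<open>1 / j - 1 / j ^ 2\<close> sum to \<open>harm N\<close>
  minus a sum of inverse squares, which lies between 0 and 2.\<close>

lemma cycle_variance_bounds:
  "harm N - 2 \<le> cycle_mean N (\<lambda>k. (real k - harm N) ^ 2)" (is ?lower)
  "cycle_mean N (\<lambda>k. (real k - harm N) ^ 2) \<le> harm N" (is ?upper)
proof -
  have "cycle_mean N (\<lambda>k. (real k - harm N) ^ 2) = (\<Sum>j<N. 1 / real (Suc j) * (1 - 1 / real (Suc j)))"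
    by (induction N) (simp_all add: cycle_mean_0 harm_expand(1) cycle_mean_square_Suc del: of_nat_Suc)
  also have "\<dots> = harm N - (\<Sum>j<N. 1 / real (Suc j) ^ 2)"
    by (induction N) (simp_all add: harm_Suc harm_expand(1) right_diff_distrib power2_eq_square
        inverse_eq_divide del: of_nat_Suc)
  finally have *: "cycle_mean N (\<lambda>k. (real k - harm N) ^ 2) = harm N - (\<Sum>j<N. 1 / real (Suc j) ^ 2)" .
  have "(\<Sum>j<N. 1 / real (Suc j) ^ 2) \<ge> 0" by (intro sum_nonneg) auto
  then show ?lower ?upper using * sum_inverse_squares_le[of N] by auto
qed

text \<open>Each step of the recursion adds at most \<open>6 * p * harm N + p\<close>, while the
  right-hand side grows by that amount plus \<open>3 * p ^ 2\<close>.\<close>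

lemma cycle_mean_fourth_power_le:
  "cycle_mean N (\<lambda>k. (real k - harm N) ^ 4) \<le> 3 * harm N ^ 2 + harm N"
proof (induction N)
  case (Suc N)
  define p :: real where "p = 1 / real (Suc N)"
  have h: "harm (Suc N) = harm N + p" by (simp add: harm_Suc p_def field_simps)
  have "p \<ge> 0" by (simp add: p_def)
  then have "p * cycle_mean N (\<lambda>k. (real k - harm N) ^ 2) \<le> p * harm N"
    by (intro mult_left_mono cycle_variance_bounds)
  then have "cycle_mean (Suc N) (\<lambda>k. (real k - harm (Suc N)) ^ 4) \<le>
      3 * harm N ^ 2 + harm N + 6 * p * harm N + p"
    using cycle_mean_fourth_power_Suc[of N, folded p_def] Suc by simp
  also have "\<dots> \<le> 3 * (harm N + p) ^ 2 + (harm N + p)"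
    by (simp add: power2_eq_square algebra_simps)
  finally show ?case unfolding h .
qed (simp add: cycle_mean_0 harm_def)

subsection \<open>Transitivity\<close>

definition swap_pair :: "nat \<Rightarrow> nat" where
  "swap_pair h = (if even h then h + 1 else h - 1)"

lemma swap_pair_simps [simp]:
  "swap_pair (swap_pair h) = h" "swap_pair h \<noteq> h" "swap_pair h div 2 = h div 2"
  "swap_pair h < 2 * n \<longleftrightarrow> h < 2 * n"
  by (auto simp: swap_pair_def elim!: oddE evenE)

text \<open>Transitivity of the group generated by \<open>p\<close> and the pairing, expressed
  through invariant sets. On a finite set, being mapped into itself by a permutation already means
  being mapped onto itself.\<close>

definition transitive_perms :: "nat \<Rightarrow> (nat \<Rightarrow> nat) set" where
  "transitive_perms n = {p. p permutes {..<2 * n} \<and>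
     (\<forall>S\<subseteq>{..<2 * n}. S \<noteq> {} \<and> p ` S \<subseteq> S \<and> swap_pair ` S \<subseteq> S \<longrightarrow> S = {..<2 * n})}"

lemma transitive_permsD:
  assumes "p \<in> transitive_perms n" "S \<subseteq> {..<2 * n}" "S \<noteq> {}"
    "\<And>h. h \<in> S \<Longrightarrow> p h \<in> S" "\<And>h. h \<in> S \<Longrightarrow> swap_pair h \<in> S"
  shows "S = {..<2 * n}"
  using assms unfolding transitive_perms_def by (auto simp: image_subset_iff)

definition intransitive_perms :: "nat \<Rightarrow> (nat \<Rightarrow> nat) set" where
  "intransitive_perms n = {p. p permutes {..<2 * n}} - transitive_perms n"

definition intransitive_fraction :: "nat \<Rightarrow> real" where
  "intransitive_fraction n = real (card (intransitive_perms n)) / fact (2 * n)"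

text \<open>By finiteness and injectivity such a permutation maps \<open>S\<close> onto
  \<open>S\<close>, so it is the composite of a permutation of \<open>S\<close> and one of the
  complement.\<close>

lemma card_permutes_invariant_le:
  assumes "finite A" "S \<subseteq> A"
  shows "card {p. p permutes A \<and> p ` S \<subseteq> S} \<le> fact (card S) * fact (card A - card S)"
proof -
  have fin: "finite S" "finite (A - S)" using assms finite_subset by auto
  have "{p. p permutes A \<and> p ` S \<subseteq> S} \<subseteq> (\<lambda>(q, r). q \<circ> r) ` ({q. q permutes S} \<times> {r. r permutes A - S})"
  proof safe
    fix p assume p: "p permutes A" and S: "p ` S \<subseteq> S"
    have inj: "inj p" using p by (rule permutes_inj)
    have pS: "p ` S = S" using S fin inj by (metis endo_inj_surj inj_on_subset subset_UNIV)
    define q where "q = perm_restrict p S"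
    define r where "r = perm_restrict p (A - S)"
    have "p ` (A - S) = A - S"
      using p pS inj by (simp add: image_set_diff permutes_image)
    then have "bij_betw p S S" "bij_betw p (A - S) (A - S)"
      using pS inj by (auto simp: bij_betw_def intro: inj_on_subset)
    then have "bij_betw q S S" "bij_betw r (A - S) (A - S)"
      using bij_betw_cong[of S q p S] bij_betw_cong[of "A - S" r p "A - S"]
      by (auto simp: q_def r_def perm_restrict_def)
    then have "q permutes S" "r permutes A - S"
      by (auto intro!: bij_imp_permutes simp: q_def r_def perm_restrict_def split: if_splits)
    moreover have "p = q \<circ> r"
    proof
      fix x
      show "p x = (q \<circ> r) x"
        using p \<open>p ` (A - S) = A - S\<close>
        by (cases "x \<in> S"; cases "x \<in> A") (auto simp: q_def r_def perm_restrict_def permutes_def)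
    qed
    ultimately show "p \<in> (\<lambda>(q, r). q \<circ> r) ` ({q. q permutes S} \<times> {r. r permutes A - S})"
      by auto
  qed
  then have "card {p. p permutes A \<and> p ` S \<subseteq> S} \<le>
      card ({q. q permutes S} \<times> {r. r permutes A - S})"
    using fin by (intro surj_card_le finite_cartesian_product finite_permutations)
  also have "\<dots> = fact (card S) * fact (card A - card S)"
    using fin assms by (simp add: card_cartesian_product card_permutations card_Diff_subset)
  finally show ?thesis .
qed

lemma card_div2_vimage:
  assumes "finite T"
  shows "card {h::nat. h div 2 \<in> T} = 2 * card T"
proof -
  have "{h::nat. h div 2 \<in> T} = (\<lambda>i. 2 * i) ` T \<union> (\<lambda>i. 2 * i + 1) ` T"
  proof safe
    fix h :: nat assume "h div 2 \<in> T" "h \<notin> (\<lambda>i. 2 * i + 1) ` T"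
    moreover have "h = 2 * (h div 2) \<or> h = 2 * (h div 2) + 1" by presburger
    ultimately show "h \<in> (\<lambda>i. 2 * i) ` T" by blast
  qed auto
  moreover have "(\<lambda>i. 2 * i) ` T \<inter> (\<lambda>i. 2 * i + 1) ` T = {}" by auto presburger
  ultimately show ?thesis using assms by (simp add: card_Un_disjoint card_image inj_on_def)
qed

text \<open>Union bound over the invariant sets. A set closed under the pairing consists of whole
  edges, so it is given by a set \<open>T\<close> of \<open>k\<close> edges and has
  \<open>2 * k\<close> elements; being proper and nonempty means
  \<open>1 \<le> k < n\<close>.\<close>

lemma card_intransitive_le:
  "card (intransitive_perms n) \<le>
    (\<Sum>k\<in>{1..<n}. (n choose k) * (fact (2 * k) * fact (2 * n - 2 * k)))"
proof -
  define I where "I S = {p. p permutes {..<2 * n} \<and> p ` S \<subseteq> S}" for S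
  define D where "D T = {h::nat. h div 2 \<in> T}" for T
  have finI: "finite (I S)" for S
    unfolding I_def by (rule finite_subset[OF _ finite_permutations]) auto
  have "intransitive_perms n \<subseteq>
      (\<Union>k\<in>{1..<n}. \<Union>T\<in>{T. T \<subseteq> {..<n} \<and> card T = k}. I (D T))"
  proof
    fix p assume "p \<in> intransitive_perms n"
    then obtain S where p: "p permutes {..<2 * n}" and S: "S \<subseteq> {..<2 * n}" "S \<noteq> {}" "S \<noteq> {..<2 * n}"
      and inv: "p ` S \<subseteq> S" "swap_pair ` S \<subseteq> S"
      by (auto simp: transitive_perms_def intransitive_perms_def)
    define T where "T = (\<lambda>h. h div 2) ` S"
    have "h \<in> S" if "h' \<in> S" "h div 2 = h' div 2" for h h'
    proof -
      have "h = h' \<or> h = swap_pair h'" using that(2) unfolding swap_pair_def by presburger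
      then show ?thesis using that inv(2) by auto
    qed
    then have D: "S = D T" by (auto simp: T_def D_def)
    have T: "T \<subseteq> {..<n}" using S(1) by (auto simp: T_def)
    then have "finite T" by (rule finite_subset) simp
    then have "2 * card T = card S" by (simp add: D D_def card_div2_vimage)
    moreover have "card S < 2 * n" using S psubset_card_mono[of "{..<2 * n}" S] by auto
    moreover have "card S > 0" using S by (meson card_gt_0_iff finite_lessThan finite_subset)
    ultimately have "card T \<in> {1..<n}" by auto
    moreover have "p \<in> I (D T)" using p inv by (simp add: I_def D)
    ultimately show "p \<in> (\<Union>k\<in>{1..<n}. \<Union>T\<in>{T. T \<subseteq> {..<n} \<and> card T = k}. I (D T))"
      using T by blast
  qed
  then have "card (intransitive_perms n) \<le>
      card (\<Union>k\<in>{1..<n}. \<Union>T\<in>{T. T \<subseteq> {..<n} \<and> card T = k}. I (D T))"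
    by (intro card_mono) (auto intro: finI)
  also have "\<dots> \<le> (\<Sum>k\<in>{1..<n}. card (\<Union>T\<in>{T. T \<subseteq> {..<n} \<and> card T = k}. I (D T)))"
    by (rule card_UN_le) simp
  also have "\<dots> \<le> (\<Sum>k\<in>{1..<n}. (n choose k) * (fact (2 * k) * fact (2 * n - 2 * k)))"
  proof (rule sum_mono)
    fix k assume "k \<in> {1..<n}"
    have "card (\<Union>T\<in>{T. T \<subseteq> {..<n} \<and> card T = k}. I (D T)) \<le>
        (\<Sum>T\<in>{T. T \<subseteq> {..<n} \<and> card T = k}. card (I (D T)))"
      by (rule card_UN_le) simp
    also have "\<dots> \<le> (\<Sum>T\<in>{T. T \<subseteq> {..<n} \<and> card T = k}. fact (2 * k) * fact (2 * n - 2 * k))"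
    proof (rule sum_mono)
      fix T assume T: "T \<in> {T. T \<subseteq> {..<n} \<and> card T = k}"
      then have "card (D T) = 2 * k" "D T \<subseteq> {..<2 * n}"
        using finite_subset[of T "{..<n}"] by (auto simp: D_def card_div2_vimage)
      then show "card (I (D T)) \<le> fact (2 * k) * fact (2 * n - 2 * k)"
        using card_permutes_invariant_le[of "{..<2 * n}" "D T"] by (simp add: I_def)
    qed
    also have "\<dots> = (n choose k) * (fact (2 * k) * fact (2 * n - 2 * k))"
      using n_subsets[of "{..<n}" k] by simp
    finally show "card (\<Union>T\<in>{T. T \<subseteq> {..<n} \<and> card T = k}. I (D T)) \<le>
        (n choose k) * (fact (2 * k) * fact (2 * n - 2 * k))" .
  qed
  finally show ?thesis .
qed

text \<open>The left-hand side is the middle term of Vandermonde's sum for the right-hand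
  side.\<close>

lemma binomial_square_le: "(n choose k)\<^sup>2 \<le> (2 * n) choose (2 * k)"
proof -
  have "(n choose k) * (n choose (2 * k - k)) \<le> (\<Sum>j\<le>2 * k. (n choose j) * (n choose (2 * k - j)))"
    by (rule member_le_sum) auto
  then show ?thesis using vandermonde[of n n "2 * k"] by (simp add: power2_eq_square mult_2)
qed

text \<open>Binomial coefficients increase up to the middle; for \<open>k\<close> beyond the middle,
  reflect to \<open>n - k\<close>, which is still at least 2.\<close>

lemma choose_two_le:
  assumes "2 \<le> k" "k + 2 \<le> n"
  shows "n choose 2 \<le> n choose k"
proof (cases "2 * k \<le> n")
  case True
  then show ?thesis using assms by (intro binomial_mono) auto
next
  case False
  then have "n choose 2 \<le> n choose (n - k)" using assms by (intro binomial_mono) auto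
  then show ?thesis using assms by (simp add: binomial_symmetric[of k n])
qed

text \<open>The term for \<open>k\<close> in the union bound is a quotient of binomial coefficients
  and is at most \<open>1 / (n choose k)\<close>. The terms \<open>k = 1\<close> and
  \<open>k = n - 1\<close> give \<open>1 / n\<close> each, and every other term is of order
  \<open>1 / n ^ 2\<close>.\<close>

lemma intransitive_fraction_le:
  assumes "n \<ge> 2"
  shows "intransitive_fraction n \<le> 6 / real n"
proof -
  have term_le: "real ((n choose k) * (fact (2 * k) * fact (2 * n - 2 * k))) / fact (2 * n) \<le>
      1 / real (n choose k)" if "k \<in> {1..<n}" for k
  proof -
    have pos: "real (n choose k) > 0" using that by simp
    have "real ((2 * n) choose (2 * k)) = fact (2 * n) / (fact (2 * k) * fact (2 * n - 2 * k))"
      using that by (intro binomial_fact) auto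
    then have "real ((2 * n) choose (2 * k)) * (fact (2 * k) * fact (2 * n - 2 * k)) = fact (2 * n)"
      by simp
    moreover have "real (n choose k) ^ 2 \<le> real ((2 * n) choose (2 * k))"
      using binomial_square_le[of n k] by (metis of_nat_le_iff of_nat_power)
    ultimately have "real (n choose k) ^ 2 * (fact (2 * k) * fact (2 * n - 2 * k)) \<le> fact (2 * n)"
      by (metis mult_right_mono fact_ge_zero mult_nonneg_nonneg)
    then show ?thesis using pos by (simp add: field_simps power2_eq_square)
  qed
  have inv_le: "1 / real (n choose k) \<le> (if k \<in> {1, n - 1} then 1 / real n else 2 / (real n * (real n - 1)))"
    if "k \<in> {1..<n}" for k
  proof (cases "k \<in> {1, n - 1}")
    case True
    then have "n choose k = n" using assms binomial_symmetric[of 1 n] by auto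
    then show ?thesis using True by simp
  next
    case False
    then have "n choose 2 \<le> n choose k" using that by (intro choose_two_le) auto
    then have "real n * (real n - 1) / 2 \<le> real (n choose k)"
      unfolding of_nat_le_iff[where 'a = real, symmetric] using assms
      by (simp add: choose_two real_of_nat_div of_nat_diff)
    then have "1 / real (n choose k) \<le> 1 / (real n * (real n - 1) / 2)"
      using assms that by (intro divide_left_mono mult_pos_pos) auto
    then show ?thesis using False that by simp
  qed
  have "intransitive_fraction n \<le> real (\<Sum>k\<in>{1..<n}. (n choose k) * (fact (2 * k) * fact (2 * n - 2 * k))) / fact (2 * n)"
    unfolding intransitive_fraction_def by (intro divide_right_mono of_nat_mono card_intransitive_le) simp
  also have "\<dots> = (\<Sum>k\<in>{1..<n}. real ((n choose k) * (fact (2 * k) * fact (2 * n - 2 * k))) / fact (2 * n))"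
    by (simp add: sum_divide_distrib)
  \<comment> \<open>The bound for the inner terms is added to the extreme ones too, so that its
    \<open>n - 1\<close> copies sum to exactly \<open>2 / n\<close>.\<close>
  also have "\<dots> \<le> (\<Sum>k\<in>{1..<n}. (if k \<in> {1, n - 1} then 1 / real n else 0) + 2 / (real n * (real n - 1)))"
    using assms by (intro sum_mono order_trans[OF term_le] order_trans[OF inv_le]) auto
  also have "\<dots> = (\<Sum>k\<in>{1..<n} \<inter> {1, n - 1}. 1 / real n) + 2 / real n"
  proof -
    have "(\<Sum>k\<in>{1..<n}. if k \<in> {1, n - 1} then 1 / real n else 0) =
        (\<Sum>k\<in>{1..<n} \<inter> {1, n - 1}. 1 / real n)"
      by (rule sum.inter_restrict[symmetric]) simp
    moreover have "real (n - 1) * (2 / (real n * (real n - 1))) = 2 / real n"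
      using assms by (simp add: of_nat_diff field_simps)
    ultimately show ?thesis by (simp only: sum.distrib sum_constant card_atLeastLessThan)
  qed
  also have "\<dots> \<le> 2 / real n + 2 / real n"
    using card_mono[of "{1, n - 1}" "{1..<n} \<inter> {1, n - 1}"]
    by (auto simp: divide_simps card_insert_if split: if_splits)
  also have "\<dots> \<le> 6 / real n" by (simp add: divide_simps)
  finally show ?thesis .
qed

subsection \<open>Rooted maps as permutations\<close>

lemma (in comb_map) hedges_at_eq_orbit:
  assumes "h \<in> hedges M"
  shows "hedges_at M (endpt M h) = orbit (rot M) h"
proof -
  have "h \<in> hedges_at M (endpt M h)" using assms by (simp add: hedges_at_def)
  then show ?thesis using cyclic_rot[OF endpt_in[OF assms]] cyclic_on_alldef by fastforce
qed

text \<open>Each half-edge lies in its own orbit under the rotation, hence is the image of some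
  half-edge. Injectivity then follows by finiteness.\<close>

lemma (in comb_map) rot_surj: "rot M ` hedges M = hedges M"
proof
  show "hedges M \<subseteq> rot M ` hedges M"
  proof
    fix h assume h: "h \<in> hedges M"
    then have "h \<in> hedges_at M (endpt M h)" by (simp add: hedges_at_def)
    then have "h \<in> orbit (rot M) h" using hedges_at_eq_orbit[OF h] by simp
    moreover have "orbit (rot M) h \<subseteq> hedges M"
      using hedges_at_eq_orbit[OF h] by (auto simp: hedges_at_def)
    ultimately show "h \<in> rot M ` hedges M"
      by (cases rule: orbit.cases) (use h in auto)
  qed
qed (auto intro: rot_in)

lemma (in comb_map) bij_betw_rot: "bij_betw (rot M) (hedges M) (hedges M)"
  unfolding bij_betw_def using rot_surj eq_card_imp_inj_on[OF finite_hedges, of "rot M"] by simp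

text \<open>A path from \<open>v\<close> to the end of some half-edge is either trivial or starts
  with a half-edge at \<open>v\<close>.\<close>

lemma (in comb_map) hedges_at_nonempty:
  assumes "hedges M \<noteq> {}" "v \<in> verts M"
  shows "hedges_at M v \<noteq> {}"
proof -
  obtain h where h: "h \<in> hedges M" using assms by auto
  have "(v, endpt M h) \<in> (adj M)\<^sup>*" by (rule connected[OF assms(2) endpt_in[OF h]])
  then show ?thesis
    by (cases rule: converse_rtranclE) (use h in \<open>auto simp: hedges_at_def adj_def\<close>)
qed

text \<open>Connectedness as transitivity: closure under the rotation yields all half-edges at a
  vertex, and closure under \<open>opp\<close> passes this on to the adjacent vertices.\<close>

lemma (in comb_map) closed_hedges_eq:
  assumes S: "S \<subseteq> hedges M" "S \<noteq> {}"
    and rot: "\<And>h. h \<in> S \<Longrightarrow> rot M h \<in> S" and opp: "\<And>h. h \<in> S \<Longrightarrow> opp M h \<in> S"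
  shows "S = hedges M"
proof
  have at: "hedges_at M (endpt M h) \<subseteq> S" if h: "h \<in> S" for h
  proof -
    have "orbit (rot M) h \<subseteq> S"
    proof
      fix k assume "k \<in> orbit (rot M) h"
      then show "k \<in> S" by induction (auto intro: rot h)
    qed
    moreover have "h \<in> hedges M" using h S by auto
    ultimately show ?thesis by (simp add: hedges_at_eq_orbit)
  qed
  obtain h where h: "h \<in> S" using S by auto
  have "hedges_at M v \<subseteq> S" if "(endpt M h, v) \<in> (adj M)\<^sup>*" for v
    using that
  proof induction
    case (step v w)
    then obtain k where k: "k \<in> hedges M" "v = endpt M k" "w = endpt M (opp M k)"
      by (auto simp: adj_def)
    then have "k \<in> S" using step.IH by (auto simp: hedges_at_def)
    then show ?case using at[OF opp] k by simp
  qed (rule at[OF h])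
  then show "hedges M \<subseteq> S"
    using connected[OF endpt_in endpt_in] h S by (auto simp: hedges_at_def subset_iff)
qed (rule S)

lemma (in comb_map) card_hedges: "card (hedges M) = 2 * card (edges M)"
proof -
  have U: "\<Union> (edges M) = hedges M" using opp_in by (auto simp: edges_def)
  have "2 * card (edges M) = card (\<Union> (edges M))"
  proof (rule card_partition)
    show "finite (edges M)" "finite (\<Union> (edges M))"
      using finite_hedges by (simp add: edges_def, simp add: U)
    show "card e = 2" if "e \<in> edges M" for e
      using that opp_neq by (fastforce simp: edges_def)
    show "e \<inter> e' = {}" if "e \<in> edges M" "e' \<in> edges M" "e \<noteq> e'" for e e'
    proof (rule ccontr)
      assume "e \<inter> e' \<noteq> {}"
      then obtain x where x: "x \<in> e" "x \<in> e'" by blast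
      have "d = {x, opp M x}" if d: "d \<in> edges M" "x \<in> d" for d
      proof -
        obtain h where "h \<in> hedges M" "d = {h, opp M h}" using d by (auto simp: edges_def)
        then show ?thesis using d opp_opp[of h] by auto
      qed
      then show False using that x by blast
    qed
  qed
  then show ?thesis by (simp add: U)
qed

text \<open>Vertices correspond to cycles of the rotation, and \<open>g\<close> carries the cycles
  of one map to those of the other, so the vertex bijection is determined by \<open>g\<close>. As
  there are half-edges, every vertex carries one.\<close>

lemma map_iso_of_hedges:
  assumes M: "comb_map M" and N: "comb_map N" and ne: "hedges M \<noteq> {}"
    and g: "bij_betw g (hedges M) (hedges N)"
    and opp: "\<And>h. h \<in> hedges M \<Longrightarrow> opp N (g h) = g (opp M h)"
    and rot: "\<And>h. h \<in> hedges M \<Longrightarrow> rot N (g h) = g (rot M h)"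
  shows "\<exists>f. map_iso f g M N"
proof -
  interpret M: comb_map M by fact
  interpret N: comb_map N by fact
  have gN: "hedges N = g ` hedges M" and inj: "inj_on g (hedges M)"
    using g by (auto simp: bij_betw_def)
  have at: "hedges_at N (endpt N (g h)) = g ` hedges_at M (endpt M h)" if h: "h \<in> hedges M" for h
  proof -
    have hh: "h \<in> hedges_at M (endpt M h)" using h by (simp add: hedges_at_def)
    have "cyclic_on (rot N) (g ` hedges_at M (endpt M h))"
      using M.cyclic_rot[OF M.endpt_in[OF h]] hh
      by (intro cyclic_on_image) (auto simp: rot hedges_at_def)
    then have "g ` hedges_at M (endpt M h) = orbit (rot N) (g h)"
      using hh unfolding cyclic_on_alldef by blast
    then show ?thesis using N.hedges_at_eq_orbit[of "g h"] h gN by auto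
  qed
  have ends: "endpt N (g h) = endpt N (g k) \<longleftrightarrow> endpt M h = endpt M k"
    if h: "h \<in> hedges M" and k: "k \<in> hedges M" for h k
  proof
    assume "endpt N (g h) = endpt N (g k)"
    then have "g k \<in> hedges_at N (endpt N (g h))" using k gN by (simp add: hedges_at_def)
    then have "k \<in> hedges_at M (endpt M h)"
      unfolding at[OF h] by (subst (asm) inj_on_image_mem_iff[OF inj k]) (auto simp: hedges_at_def)
    then show "endpt M h = endpt M k" by (simp add: hedges_at_def)
  next
    assume "endpt M h = endpt M k"
    then have "g k \<in> hedges_at N (endpt N (g h))" using at[OF h] k by (auto simp: hedges_at_def)
    then show "endpt N (g h) = endpt N (g k)" by (simp add: hedges_at_def)
  qed
  \<comment> \<open>Any half-edge at \<open>v\<close> may be chosen: by \<open>ends\<close> the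
    image vertex does not depend on it.\<close>
  define f where "f v = endpt N (g (SOME h. h \<in> hedges_at M v))" for v
  have f: "f (endpt M h) = endpt N (g h)" if h: "h \<in> hedges M" for h
  proof -
    have "(SOME k. k \<in> hedges_at M (endpt M h)) \<in> hedges_at M (endpt M h)"
      by (rule someI[of _ h]) (use h in \<open>simp add: hedges_at_def\<close>)
    then show ?thesis unfolding f_def using ends[OF _ h] by (auto simp: hedges_at_def)
  qed
  have V: "verts M = endpt M ` hedges M"
    using M.hedges_at_nonempty[OF ne] M.endpt_in by (fastforce simp: hedges_at_def)
  have "hedges N \<noteq> {}" using ne gN by simp
  then have "verts N = endpt N ` hedges N"
    using N.hedges_at_nonempty N.endpt_in by (fastforce simp: hedges_at_def)
  then have "bij_betw f (verts M) (verts N)"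
    unfolding V gN bij_betw_def inj_on_def by (auto simp: f ends image_image)
  then have "map_iso f g M N" using g opp rot f by (simp add: map_iso_def)
  then show ?thesis by blast
qed

text \<open>Number the edges with the edge of \<open>h0\<close> first, then give the two halves of
  edge \<open>i\<close> the labels \<open>2 * i\<close> and \<open>2 * i + 1\<close>.\<close>

lemma (in comb_map) hedge_labelling:
  assumes h0: "h0 \<in> hedges M"
  obtains g where "bij_betw g (hedges M) {..<2 * card (edges M)}" "g h0 = 0"
    "\<And>h. h \<in> hedges M \<Longrightarrow> g (opp M h) = swap_pair (g h)"
proof -
  define n where "n = card (edges M)"
  define E where "E h = {h, opp M h}" for h
  have E: "E h \<in> edges M" if "h \<in> hedges M" for h using that by (auto simp: E_def edges_def)
  have E_opp: "E (opp M h) = E h" if "h \<in> hedges M" for h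
    using that opp_opp by (auto simp: E_def)
  have fin: "finite (edges M)" using finite_hedges by (simp add: edges_def)
  obtain e0 where e0: "bij_betw e0 (edges M) {..<n}"
    using ex_bij_betw_finite_nat[OF fin] by (auto simp: n_def atLeast0LessThan)
  \<comment> \<open>The transposition gives number 0 to the edge of the root.\<close>
  define e where "e = Transposition.transpose (e0 (E h0)) 0 \<circ> e0"
  have "e0 (E h0) < n" using e0 E[OF h0] by (auto simp: bij_betw_def)
  then have "Transposition.transpose (e0 (E h0)) 0 permutes {..<n}"
    by (intro permutes_swap_id) auto
  then have e: "bij_betw e (edges M) {..<n}"
    unfolding e_def using e0 bij_betw_trans permutes_imp_bij by blast
  \<comment> \<open>\<open>r\<close> selects the half that gets the even label, which on the root
    edge must be \<open>h0\<close>.\<close>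
  define r where "r A = (if h0 \<in> A then h0 else SOME h. h \<in> A)" for A
  have r: "r (E h) \<in> E h" for h
    unfolding r_def using someI[of "\<lambda>x. x \<in> E h" h] by (simp add: E_def)
  define g where "g h = 2 * e (E h) + (if r (E h) = h then 0 else 1)" for h
  have g_opp: "g (opp M h) = swap_pair (g h)" if h: "h \<in> hedges M" for h
  proof -
    have "r (E h) = h \<or> r (E h) = opp M h" using r[of h] unfolding E_def by blast
    then show ?thesis using opp_neq[OF h] by (auto simp: g_def E_opp[OF h] swap_pair_def)
  qed
  have "inj_on g (hedges M)"
  proof (rule inj_onI)
    fix h k assume h: "h \<in> hedges M" and k: "k \<in> hedges M" and eq: "g h = g k"
    have "e (E h) = g h div 2" "e (E k) = g k div 2" by (simp_all add: g_def)
    then have "E h = E k" using eq inj_onD[OF bij_betw_imp_inj_on[OF e] _ E[OF h] E[OF k]] by simp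
    moreover have "g (opp M h) \<noteq> g h" using g_opp[OF h] by simp
    ultimately show "h = k" using eq by (auto simp: E_def doubleton_eq_iff)
  qed
  moreover have "g ` hedges M \<subseteq> {..<2 * n}"
  proof
    fix x assume "x \<in> g ` hedges M"
    then obtain h where h: "h \<in> hedges M" "x = g h" by auto
    then have "e (E h) < n" using e E by (auto simp: bij_betw_def)
    then show "x \<in> {..<2 * n}" using h by (auto simp: g_def)
  qed
  ultimately have "bij_betw g (hedges M) {..<2 * n}"
    unfolding bij_betw_def using card_hedges card_image[of g "hedges M"]
    by (intro conjI card_subset_eq) (simp_all add: n_def)
  moreover have "g h0 = 0" by (simp add: g_def r_def e_def E_def)
  ultimately show ?thesis using that g_opp by (simp add: n_def)
qed


section \<open>Rooted maps built from transitive permutations\<close>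

definition map_of_perm :: "nat \<Rightarrow> (nat \<Rightarrow> nat) \<Rightarrow> (nat, nat) emb_graph" where
  "map_of_perm n p = \<lparr>verts = (\<lambda>h. Min (orbit p h)) ` {..<2 * n}, hedges = {..<2 * n},
     endpt = (\<lambda>h. Min (orbit p h)), opp = swap_pair, rot = p\<rparr>"

lemma map_of_perm_simps [simp]:
  "verts (map_of_perm n p) = (\<lambda>h. Min (orbit p h)) ` {..<2 * n}"
  "hedges (map_of_perm n p) = {..<2 * n}"
  "endpt (map_of_perm n p) h = Min (orbit p h)"
  "opp (map_of_perm n p) = swap_pair"
  "rot (map_of_perm n p) = p"
  by (simp_all add: map_of_perm_def)

text \<open>Distinct orbits are disjoint, so the least element names its orbit. In this way cycles
  become vertices labelled by natural numbers.\<close>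

lemma Min_orbit_eq_iff:
  assumes p: "p permutes {..<N :: nat}" and h: "h < N" and k: "k < N"
  shows "Min (orbit p h) = Min (orbit p k) \<longleftrightarrow> orbit p h = orbit p k"
proof
  have Min: "Min (orbit p h) \<in> orbit p h" if "h < N" for h
    using permutes_orbit_subset[OF p, of h] that
    by (intro Min_in orbit_nonempty finite_subset[of "orbit p h"]) auto
  assume "Min (orbit p h) = Min (orbit p k)"
  then show "orbit p h = orbit p k"
    using Min[OF h] Min[OF k] permutes_orbit_eq_iff[OF _ p] by (metis finite_lessThan)
qed simp

lemma card_verts_map_of_perm:
  "p permutes {..<2 * n} \<Longrightarrow> card (verts (map_of_perm n p)) = num_cycles {..<2 * n} p"
  unfolding num_cycles_def map_of_perm_simps
  by (rule card_image_eq_kernel) (auto simp: Min_orbit_eq_iff)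

lemma transitive_perms_permutes: "p \<in> transitive_perms n \<Longrightarrow> p permutes {..<2 * n}"
  by (simp add: transitive_perms_def)

text \<open>For connectedness, the half-edges whose vertex can be reached from \<open>u\<close> are
  closed under \<open>p\<close>, which stays at the vertex, and under the pairing, which follows an
  edge; transitivity makes them all half-edges.\<close>

lemma comb_map_map_of_perm:
  assumes n: "n > 0" and p: "p \<in> transitive_perms n"
  shows "comb_map (map_of_perm n p)"
proof
  let ?M = "map_of_perm n p"
  have perm: "p permutes {..<2 * n}" using p by (rule transitive_perms_permutes)
  have self: "h \<in> orbit p h" for h
    using perm by (meson finite_lessThan permutation_permutes permutation_self_in_orbit)
  show "cyclic_on (rot ?M) (hedges_at ?M v)" if v: "v \<in> verts ?M" for v
  proof -
    obtain h where h: "h < 2 * n" "v = Min (orbit p h)" using v by auto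
    have "hedges_at ?M v = {k. k < 2 * n \<and> orbit p h = orbit p k}"
      using Min_orbit_eq_iff[OF perm _ h(1)] h(2) by (auto simp: hedges_at_def)
    also have "\<dots> = orbit p h"
      using permutes_orbit_subset[OF perm, of h] h(1) permutes_orbit_eq_iff[OF _ perm] by auto
    finally show ?thesis
      using perm by (metis cyclic_on_orbit finite_lessThan map_of_perm_simps(5))
  qed
  show "(u, v) \<in> (adj ?M)\<^sup>*" if uv: "u \<in> verts ?M" "v \<in> verts ?M" for u v
  proof -
    define S where "S = {h. h < 2 * n \<and> (u, endpt ?M h) \<in> (adj ?M)\<^sup>*}"
    have "S = {..<2 * n}"
    proof (rule transitive_permsD[OF p])
      show "S \<subseteq> {..<2 * n}" by (auto simp: S_def)
      show "S \<noteq> {}" using uv(1) by (auto simp: S_def)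
      show "p h \<in> S" if "h \<in> S" for h
      proof -
        have "orbit p h = orbit p (p h)"
          using permutes_orbit_eq_iff[OF _ perm] orbit.base[of p h] by blast
        then show ?thesis using that permutes_in_image[OF perm, of h] by (simp add: S_def)
      qed
      show "swap_pair h \<in> S" if "h \<in> S" for h
      proof -
        have "(endpt ?M h, endpt ?M (swap_pair h)) \<in> adj ?M"
          using that by (auto simp: adj_def S_def)
        then show ?thesis using that by (auto simp: S_def intro: rtrancl_into_rtrancl)
      qed
    qed
    then show ?thesis using uv(2) by (auto simp: S_def)
  qed
qed (use n in \<open>auto simp: lessThan_empty_iff\<close>)

lemma map_of_perm_rooted:
  assumes n: "n > 0" and p: "p \<in> transitive_perms n"
  shows "(map_of_perm n p, Between 0) \<in> labelled_rooted_maps n"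
proof -
  interpret comb_map "map_of_perm n p" using comb_map_map_of_perm[OF n p] .
  have "card (edges (map_of_perm n p)) = n" using card_hedges by simp
  then show ?thesis
    using n comb_map_map_of_perm[OF n p] by (simp add: labelled_rooted_maps_def corners_def)
qed

definition map_class :: "nat \<Rightarrow> (nat \<Rightarrow> nat) \<Rightarrow> (nat, nat) rooted set" where
  "map_class n p = rooted_iso_rel n `` {(map_of_perm n p, Between 0)}"

lemma map_class_in: "n > 0 \<Longrightarrow> p \<in> transitive_perms n \<Longrightarrow> map_class n p \<in> rooted_maps n"
  unfolding map_class_def rooted_maps_def by (intro quotientI map_of_perm_rooted)

lemma num_verts_map_class:
  assumes "n > 0" "p \<in> transitive_perms n"
  shows "num_verts (map_class n p) = num_cycles {..<2 * n} p"
proof -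
  have "(map_of_perm n p, Between 0) \<in> map_class n p"
    unfolding map_class_def
    by (rule equiv_class_self[OF equiv_rooted_iso_rel map_of_perm_rooted[OF assms]])
  then show ?thesis
    using num_verts_class[OF map_class_in[OF assms]] card_verts_map_of_perm
      transitive_perms_permutes[OF assms(2)] by simp
qed

text \<open>Transport the rotation along a labelling that turns the edges into the fixed pairs and
  the root into 0. Invariant sets pull back to closed sets of half-edges, so connectedness gives
  transitivity.\<close>

lemma rooted_map_obtain_perm:
  assumes n: "n > 0" and C: "C \<in> rooted_maps n"
  obtains p where "p \<in> transitive_perms n" "C = map_class n p"
proof -
  obtain M c where R: "(M, c) \<in> labelled_rooted_maps n" and C: "C = rooted_iso_rel n `` {(M, c)}"
    using C by (auto simp: rooted_maps_def elim: quotientE)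
  have M: "comb_map M" and card: "card (edges M) = n" and c: "c \<in> corners M"
    using R by (auto simp: labelled_rooted_maps_def)
  interpret comb_map M by (rule M)
  have ne: "hedges M \<noteq> {}" using card n by (auto simp: edges_def)
  \<comment> \<open>With an edge present no vertex is isolated, so the root corner cannot be a
    \<open>Lone\<close> one.\<close>
  obtain h0 where h0: "h0 \<in> hedges M" "c = Between h0"
    using c hedges_at_nonempty[OF ne] by (auto simp: corners_def)
  obtain g where g: "bij_betw g (hedges M) {..<2 * n}" "g h0 = 0"
    and opp: "\<And>h. h \<in> hedges M \<Longrightarrow> g (opp M h) = swap_pair (g h)"
    using hedge_labelling[OF h0(1)] card by metis
  have inj: "inj_on g (hedges M)" and img: "g ` hedges M = {..<2 * n}"
    using g(1) by (auto simp: bij_betw_def)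
  \<comment> \<open>Beyond the labels \<open>p\<close> is the identity, as \<open>permutes\<close>
    demands.\<close>
  define p where "p k = (if k < 2 * n then g (rot M (inv_into (hedges M) g k)) else k)" for k
  have pg: "p (g h) = g (rot M h)" if "h \<in> hedges M" for h
    using that img by (auto simp: p_def inv_into_f_f[OF inj])
  have "bij_betw (g \<circ> rot M \<circ> inv_into (hedges M) g) {..<2 * n} {..<2 * n}"
    using bij_betw_inv_into[OF g(1)] bij_betw_rot g(1) by (blast intro: bij_betw_trans)
  then have "bij_betw p {..<2 * n} {..<2 * n}"
    by (rule bij_betw_cong[THEN iffD1, rotated]) (simp add: p_def)
  then have perm: "p permutes {..<2 * n}" by (rule bij_imp_permutes) (simp add: p_def)
  have p: "p \<in> transitive_perms n"
    unfolding transitive_perms_def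
  proof (intro CollectI conjI allI impI perm)
    fix S assume S: "S \<subseteq> {..<2 * n}" "S \<noteq> {} \<and> p ` S \<subseteq> S \<and> swap_pair ` S \<subseteq> S"
    define S' where "S' = {h \<in> hedges M. g h \<in> S}"
    have "S' = hedges M"
    proof (rule closed_hedges_eq)
      obtain k where k: "k \<in> S" using S by auto
      then have "k \<in> g ` hedges M" using S img by auto
      then show "S' \<noteq> {}" using k by (auto simp: S'_def)
      show "rot M h \<in> S'" if "h \<in> S'" for h
        using that S pg[of h] rot_in[of h] by (auto simp: S'_def)
      show "opp M h \<in> S'" if "h \<in> S'" for h
        using that S opp[of h] opp_in[of h] by (auto simp: S'_def)
    qed (auto simp: S'_def)
    then have "g ` hedges M \<subseteq> S" by (auto simp: S'_def)
    then show "S = {..<2 * n}" using S(1) img by simp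
  qed
  have "\<exists>f. map_iso f g M (map_of_perm n p)"
    using g(1) opp pg by (intro map_iso_of_hedges M comb_map_map_of_perm n p ne) auto
  then have "rooted_isomorphic (M, c) (map_of_perm n p, Between 0)"
    using g(2) by (force simp: rooted_isomorphic_def h0(2))
  then have "((M, c), (map_of_perm n p, Between 0)) \<in> rooted_iso_rel n"
    using R map_of_perm_rooted[OF n p] by (simp add: rooted_iso_rel_def)
  then have "C = map_class n p"
    unfolding C map_class_def by (rule equiv_class_eq[OF equiv_rooted_iso_rel])
  with p show ?thesis by (rule that)
qed

section \<open>Relabellings and the fibres of \<open>map_class\<close>\<close>

definition relabellings :: "nat \<Rightarrow> (nat \<Rightarrow> nat) set" where
  "relabellings n = {g. g permutes {..<2 * n} \<and> g 0 = 0 \<and>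
     (\<forall>h<2 * n. g (swap_pair h) = swap_pair (g h))}"

text \<open>The preimage under \<open>g\<close> of an invariant set of the conjugate is invariant
  under \<open>p\<close>, and also under the pairing since \<open>g\<close> commutes with
  it.\<close>

lemma conjugate_transitive:
  assumes p: "p \<in> transitive_perms n" and g: "g \<in> relabellings n"
  shows "g \<circ> p \<circ> inv g \<in> transitive_perms n"
proof -
  let ?q = "g \<circ> p \<circ> inv g"
  have gperm: "g permutes {..<2 * n}" and gs: "\<And>h. h < 2 * n \<Longrightarrow> g (swap_pair h) = swap_pair (g h)"
    using g by (auto simp: relabellings_def)
  note pperm = transitive_perms_permutes[OF p]
  have qg: "?q (g h) = g (p h)" for h using gperm by (simp add: permutes_inverses)
  show ?thesis
    unfolding transitive_perms_def
  proof (intro CollectI conjI allI impI)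
    show "?q permutes {..<2 * n}" by (intro permutes_compose permutes_inv gperm pperm)
    fix S assume S: "S \<subseteq> {..<2 * n}" "S \<noteq> {} \<and> ?q ` S \<subseteq> S \<and> swap_pair ` S \<subseteq> S"
    define S' where "S' = {h. h < 2 * n \<and> g h \<in> S}"
    have "S' = {..<2 * n}"
    proof (rule transitive_permsD[OF p])
      obtain k where k: "k \<in> S" using S by auto
      obtain h where h: "k = g h" using gperm by (metis permutes_def)
      then have "h < 2 * n" using k S(1) permutes_in_image[OF gperm, of h] by auto
      then show "S' \<noteq> {}" using k h by (auto simp: S'_def)
      show "p h \<in> S'" if "h \<in> S'" for h
        using that S qg[of h] permutes_in_image[OF pperm, of h] by (auto simp: S'_def simp del: comp_apply)
      show "swap_pair h \<in> S'" if "h \<in> S'" for h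
        using that S gs[of h] by (auto simp: S'_def)
    qed (auto simp: S'_def)
    then have "g ` {..<2 * n} \<subseteq> S" by (auto simp: S'_def)
    then show "S = {..<2 * n}" using S(1) permutes_image[OF gperm] by auto
  qed
qed

text \<open>The half-edges on which two relabellings agree form a nonempty set closed under \<open>p\<close> and the
  pairing.\<close>

lemma inj_on_conjugate:
  assumes n: "n > 0" and p: "p \<in> transitive_perms n"
  shows "inj_on (\<lambda>g. g \<circ> p \<circ> inv g) (relabellings n)"
proof (rule inj_onI)
  fix g k assume g: "g \<in> relabellings n" and k: "k \<in> relabellings n"
    and eq: "g \<circ> p \<circ> inv g = k \<circ> p \<circ> inv k"
  have gperm: "g permutes {..<2 * n}" and kperm: "k permutes {..<2 * n}"
    using g k by (auto simp: relabellings_def)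
  have "g (p h) = (g \<circ> p \<circ> inv g) (g h)" for h using gperm by (simp add: permutes_inverses)
  moreover have "k (p h) = (g \<circ> p \<circ> inv g) (k h)" for h
    unfolding eq using kperm by (simp add: permutes_inverses)
  ultimately have p_step: "g (p h) = k (p h)" if "g h = k h" for h using that by metis
  have "{h. h < 2 * n \<and> g h = k h} = {..<2 * n}"
  proof (rule transitive_permsD[OF p])
    show "{h. h < 2 * n \<and> g h = k h} \<noteq> {}"
      using n g k by (auto simp: relabellings_def intro!: exI[of _ 0])
    show "p h \<in> {h. h < 2 * n \<and> g h = k h}" if "h \<in> {h. h < 2 * n \<and> g h = k h}" for h
      using that p_step permutes_in_image[OF transitive_perms_permutes[OF p], of h] by simp
    show "swap_pair h \<in> {h. h < 2 * n \<and> g h = k h}" if "h \<in> {h. h < 2 * n \<and> g h = k h}" for h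
      using that g k by (simp add: relabellings_def)
  qed auto
  then have "g h = k h" for h
    using gperm kperm by (cases "h < 2 * n") (auto simp: permutes_def)
  then show "g = k" by auto
qed

text \<open>On half-edges, an isomorphism of two such rooted maps commutes with the pairing and
  fixes the root 0, so it is a relabelling that conjugates one rotation into the other. Conversely
  \<open>map_iso_of_hedges\<close> supplies the vertex part.\<close>

lemma map_class_fibre:
  assumes n: "n > 0" and p: "p \<in> transitive_perms n"
  shows "{q \<in> transitive_perms n. map_class n q = map_class n p} =
    (\<lambda>g. g \<circ> p \<circ> inv g) ` relabellings n"
proof (intro equalityI subsetI)
  note pperm = transitive_perms_permutes[OF p]
  fix q assume "q \<in> {q \<in> transitive_perms n. map_class n q = map_class n p}"
  then have q: "q \<in> transitive_perms n" and eq: "map_class n p = map_class n q" by auto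
  note qperm = transitive_perms_permutes[OF q]
  have "((map_of_perm n p, Between 0), (map_of_perm n q, Between 0)) \<in> rooted_iso_rel n"
    using eq unfolding map_class_def
    by (rule eq_equiv_class[OF _ equiv_rooted_iso_rel map_of_perm_rooted[OF n q]])
  then obtain f g0 where iso: "map_iso f g0 (map_of_perm n p) (map_of_perm n q)" "g0 0 = 0"
    by (auto simp: rooted_iso_rel_def rooted_isomorphic_def)
  \<comment> \<open>\<open>g0\<close> is arbitrary outside the half-edges and is replaced there by
    the identity.\<close>
  define g where "g h = (if h < 2 * n then g0 h else h)" for h
  have "bij_betw g0 {..<2 * n} {..<2 * n}" using iso by (simp add: map_iso_def)
  then have "bij_betw g {..<2 * n} {..<2 * n}"
    by (rule bij_betw_cong[THEN iffD1, rotated]) (simp add: g_def)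
  then have gperm: "g permutes {..<2 * n}" by (rule bij_imp_permutes) (simp add: g_def)
  have "g (swap_pair h) = swap_pair (g h)" if "h < 2 * n" for h
    using iso that by (simp add: map_iso_def g_def)
  then have "g \<in> relabellings n" using gperm iso(2) n by (simp add: relabellings_def g_def)
  moreover have "q (g h) = g (p h)" for h
  proof (cases "h < 2 * n")
    case True
    then show ?thesis
      using iso permutes_in_image[OF pperm, of h] by (simp add: map_iso_def g_def)
  next
    case False
    then show ?thesis using pperm qperm gperm by (simp add: permutes_def)
  qed
  then have "q = g \<circ> p \<circ> inv g" using gperm by (auto simp: fun_eq_iff permutes_inverses) (metis permutes_inverses(1))
  ultimately show "q \<in> (\<lambda>g. g \<circ> p \<circ> inv g) ` relabellings n" by blast
next
  note pperm = transitive_perms_permutes[OF p]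
  fix q assume "q \<in> (\<lambda>g. g \<circ> p \<circ> inv g) ` relabellings n"
  then obtain g where g: "g \<in> relabellings n" and q_def: "q = g \<circ> p \<circ> inv g" by auto
  have q: "q \<in> transitive_perms n" unfolding q_def by (rule conjugate_transitive[OF p g])
  have gperm: "g permutes {..<2 * n}" using g by (simp add: relabellings_def)
  have "\<exists>f. map_iso f g (map_of_perm n p) (map_of_perm n q)"
    using g n permutes_imp_bij[OF gperm]
    by (intro map_iso_of_hedges comb_map_map_of_perm p q n)
      (auto simp: relabellings_def q_def permutes_inverses[OF gperm] lessThan_empty_iff)
  then have "rooted_isomorphic (map_of_perm n p, Between 0) (map_of_perm n q, Between 0)"
    using g by (auto simp: rooted_isomorphic_def relabellings_def)
  then have "((map_of_perm n p, Between 0), (map_of_perm n q, Between 0)) \<in> rooted_iso_rel n"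
    using map_of_perm_rooted[OF n p] map_of_perm_rooted[OF n q] by (simp add: rooted_iso_rel_def)
  then have "map_class n p = map_class n q"
    unfolding map_class_def by (rule equiv_class_eq[OF equiv_rooted_iso_rel])
  then show "q \<in> {q \<in> transitive_perms n. map_class n q = map_class n p}" using q by simp
qed

lemma map_pmf_of_set_uniform_fibres:
  assumes A: "finite A" "A \<noteq> {}" and fib: "\<And>x. x \<in> A \<Longrightarrow> card {z \<in> A. f z = f x} = c"
  shows "map_pmf f (pmf_of_set A) = pmf_of_set (f ` A)"
proof (rule pmf_eqI)
  fix y
  have "card A = (\<Sum>y\<in>f ` A. card {z \<in> A. f z = y})"
    using sum.image_gen[OF A(1), of "\<lambda>_. 1 :: nat" f] by simp
  also have "\<dots> = (\<Sum>y\<in>f ` A. c)" by (rule sum.cong) (auto simp: fib)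
  finally have card: "card A = card (f ` A) * c" by simp
  have "pmf (map_pmf f (pmf_of_set A)) y = card (A \<inter> f -` {y}) / card A"
    using A by (simp add: pmf_map measure_pmf_of_set)
  also have "A \<inter> f -` {y} = {z \<in> A. f z = y}" by auto
  also have "card {z \<in> A. f z = y} / card A = indicator (f ` A) y / card (f ` A)"
  proof (cases "y \<in> f ` A")
    case True
    then have "card {z \<in> A. f z = y} = c" using fib by auto
    moreover have "c \<noteq> 0" using card A by (auto simp: card_eq_0_iff)
    ultimately show ?thesis using True card by simp
  next
    case False
    then have empty: "{z \<in> A. f z = y} = {}" by auto
    show ?thesis unfolding empty using False by simp
  qed
  finally show "pmf (map_pmf f (pmf_of_set A)) y = pmf (pmf_of_set (f ` A)) y"
    using A by simp
qed

lemma finite_transitive_perms: "finite (transitive_perms n)"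
  by (rule finite_subset[OF _ finite_permutations[of "{..<2 * n}"]]) (auto simp: transitive_perms_def)

text \<open>Every fibre of \<open>map_class\<close> has as many elements as there are relabellings:
  distinct relabellings give distinct conjugates by \<open>inj_on_conjugate\<close>, which expresses
  that rooted maps have no nontrivial automorphisms.\<close>

lemma random_rooted_map_eq:
  assumes n: "n > 0"
  shows "transitive_perms n \<noteq> {}"
    and "random_rooted_map n = map_pmf (map_class n) (pmf_of_set (transitive_perms n))"
proof -
  have img: "map_class n ` transitive_perms n = rooted_maps n"
    using map_class_in[OF n] rooted_map_obtain_perm[OF n] by blast
  then show ne: "transitive_perms n \<noteq> {}" using rooted_maps_nonempty[of n] by auto
  have "card {q \<in> transitive_perms n. map_class n q = map_class n p} = card (relabellings n)"
    if "p \<in> transitive_perms n" for p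
    unfolding map_class_fibre[OF n that] by (rule card_image[OF inj_on_conjugate[OF n that]])
  then show "random_rooted_map n = map_pmf (map_class n) (pmf_of_set (transitive_perms n))"
    unfolding random_rooted_map_def img[symmetric]
    by (rule map_pmf_of_set_uniform_fibres[OF finite_transitive_perms ne, symmetric])
qed

subsection \<open>Transfer to rooted maps\<close>

definition vertex_mean :: "nat \<Rightarrow> (nat \<Rightarrow> 'a::{real_normed_field, banach, second_countable_topology}) \<Rightarrow> 'a" where
  "vertex_mean n f = measure_pmf.expectation (random_rooted_map n) (\<lambda>C. f (num_verts C))"

lemma intransitive_fraction_nonneg: "intransitive_fraction n \<ge> 0"
  by (simp add: intransitive_fraction_def)

lemma vertex_mean_eq:
  assumes "n > 0"
  shows "vertex_mean n f = (\<Sum>p\<in>transitive_perms n. f (num_cycles {..<2 * n} p)) / of_nat (card (transitive_perms n))"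
proof -
  note ne = random_rooted_map_eq(1)[OF assms]
  have "vertex_mean n f =
      measure_pmf.expectation (pmf_of_set (transitive_perms n)) (\<lambda>p. f (num_verts (map_class n p)))"
    by (simp add: vertex_mean_def random_rooted_map_eq(2)[OF assms])
  also have "\<dots> = (\<Sum>p\<in>transitive_perms n.
      pmf (pmf_of_set (transitive_perms n)) p *\<^sub>R f (num_verts (map_class n p)))"
    using ne finite_transitive_perms by (intro integral_measure_pmf) auto
  also have "\<dots> = (\<Sum>p\<in>transitive_perms n. f (num_cycles {..<2 * n} p) / of_nat (card (transitive_perms n)))"
    using ne finite_transitive_perms
    by (intro sum.cong) (auto simp: num_verts_map_class[OF assms] scaleR_conv_of_real divide_inverse mult.commute)
  finally show ?thesis by (simp add: sum_divide_distrib)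
qed

text \<open>\<open>1 - intransitive_fraction n\<close> is the proportion of transitive permutations,
  and the sum over these is the sum over all permutations minus that over the intransitive
  ones.\<close>

lemma vertex_mean_compare:
  assumes n: "n > 0"
  shows "(1 - of_real (intransitive_fraction n)) * vertex_mean n f =
    cycle_mean (2 * n) f - (\<Sum>p\<in>intransitive_perms n. f (num_cycles {..<2 * n} p)) / fact (2 * n)"
proof -
  let ?P = "{p. p permutes {..<2 * n}}" and ?T = "transitive_perms n"
  have sub: "?T \<subseteq> ?P" and fin: "finite ?P"
    by (auto simp: transitive_perms_permutes finite_permutations)
  have "card (intransitive_perms n) = fact (2 * n) - card ?T" "card ?T \<le> fact (2 * n)"
    using card_Diff_subset[OF finite_transitive_perms sub] card_mono[OF fin sub]
      card_permutations[of "{..<2 * n}" "2 * n"] by (simp_all add: intransitive_perms_def)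
  then have "real (card (intransitive_perms n)) = fact (2 * n) - real (card ?T)"
    by (simp add: of_nat_diff)
  then have "1 - intransitive_fraction n = real (card ?T) / fact (2 * n)"
    by (simp add: intransitive_fraction_def diff_divide_distrib)
  then have "(1 - of_real (intransitive_fraction n) :: 'a) = of_nat (card ?T) / fact (2 * n)"
    by (metis of_real_1 of_real_diff of_real_divide of_real_fact of_real_of_nat_eq)
  moreover have "of_nat (card ?T) \<noteq> (0 :: 'a)"
    using random_rooted_map_eq(1)[OF n] finite_transitive_perms by simp
  ultimately have "(1 - of_real (intransitive_fraction n)) * vertex_mean n f =
      (\<Sum>p\<in>?T. f (num_cycles {..<2 * n} p)) / fact (2 * n)"
    by (simp add: vertex_mean_eq[OF n])
  also have "(\<Sum>p\<in>?T. f (num_cycles {..<2 * n} p)) = (\<Sum>p\<in>?P. f (num_cycles {..<2 * n} p)) -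
      (\<Sum>p\<in>intransitive_perms n. f (num_cycles {..<2 * n} p))"
    unfolding intransitive_perms_def sum_diff[OF fin sub] by simp
  finally show ?thesis by (simp add: cycle_mean_def diff_divide_distrib)
qed

text \<open>Of the two error terms, the rescaling of the mean and the sum over intransitive
  permutations, each is at most the intransitive fraction when \<open>f\<close> is bounded by
  1.\<close>

lemma vertex_mean_bounded_compare:
  fixes f :: "nat \<Rightarrow> 'a::{real_normed_field, banach, second_countable_topology}"
  assumes n: "n > 0" and f: "\<And>k. norm (f k) \<le> 1"
  shows "norm (vertex_mean n f - cycle_mean (2 * n) f) \<le> 2 * intransitive_fraction n"
proof -
  have "norm (vertex_mean n f) \<le> 1"
    unfolding vertex_mean_def
    by (intro order_trans[OF integral_norm_bound] measure_pmf.integral_le_const)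
      (auto intro!: f measure_pmf.integrable_const_bound[where B = 1])
  then have 1: "norm (of_real (intransitive_fraction n) * vertex_mean n f) \<le> intransitive_fraction n"
    using intransitive_fraction_nonneg[of n] by (simp add: norm_mult mult_left_le)
  have "norm (\<Sum>p\<in>intransitive_perms n. f (num_cycles {..<2 * n} p)) \<le> real (card (intransitive_perms n)) * 1"
    by (rule sum_norm_bound) (simp add: f)
  then have 2: "norm ((\<Sum>p\<in>intransitive_perms n. f (num_cycles {..<2 * n} p)) / fact (2 * n)) \<le> intransitive_fraction n"
    by (simp add: norm_divide intransitive_fraction_def divide_right_mono)
  have 3: "vertex_mean n f - cycle_mean (2 * n) f = of_real (intransitive_fraction n) * vertex_mean n f -
      (\<Sum>p\<in>intransitive_perms n. f (num_cycles {..<2 * n} p)) / fact (2 * n)"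
    using vertex_mean_compare[OF n, of f] by (simp add: algebra_simps)
  have "norm (vertex_mean n f - cycle_mean (2 * n) f) \<le> intransitive_fraction n + intransitive_fraction n"
    unfolding 3 by (rule order_trans[OF norm_triangle_ineq4 add_mono[OF 1 2]])
  then show ?thesis by simp
qed

text \<open>AM-GM in the form \<open>2 \<bar>f\<bar> \<le> \<epsilon> f\<^sup>2 + 1 / \<epsilon>\<close>.\<close>

lemma intransitive_sum_le:
  fixes f :: "nat \<Rightarrow> real"
  assumes "e > 0"
  shows "\<bar>(\<Sum>p\<in>intransitive_perms n. f (num_cycles {..<2 * n} p)) / fact (2 * n)\<bar> \<le>
    (e * cycle_mean (2 * n) (\<lambda>k. f k ^ 2) + intransitive_fraction n / e) / 2"
proof -
  let ?c = "num_cycles {..<2 * n}" and ?D = "intransitive_perms n"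
  have amgm: "\<bar>x\<bar> \<le> (e * x ^ 2 + 1 / e) / 2" for x :: real
  proof -
    have "0 \<le> (e * \<bar>x\<bar> - 1) ^ 2 / e" using assms by simp
    also have "\<dots> = e * x ^ 2 + 1 / e - 2 * \<bar>x\<bar>"
      using assms by (simp add: power2_eq_square field_simps flip: abs_mult)
    finally show ?thesis by simp
  qed
  have "\<bar>\<Sum>p\<in>?D. f (?c p)\<bar> \<le> (\<Sum>p\<in>?D. \<bar>f (?c p)\<bar>)" by (rule sum_abs)
  also have "\<dots> \<le> (\<Sum>p\<in>?D. (e * f (?c p) ^ 2 + 1 / e) / 2)" by (intro sum_mono amgm)
  also have "\<dots> = (e * (\<Sum>p\<in>?D. f (?c p) ^ 2) + real (card ?D) / e) / 2"
    by (simp add: sum.distrib sum_distrib_left flip: sum_divide_distrib)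
  also have "\<dots> \<le> (e * (\<Sum>p | p permutes {..<2 * n}. f (?c p) ^ 2) + real (card ?D) / e) / 2"
    using assms finite_permutations[of "{..<2 * n}"]
    by (intro divide_right_mono add_right_mono mult_left_mono sum_mono2) (auto simp: intransitive_perms_def)
  finally have "\<bar>\<Sum>p\<in>?D. f (?c p)\<bar> / fact (2 * n) \<le>
      (e * (\<Sum>p | p permutes {..<2 * n}. f (?c p) ^ 2) + real (card ?D) / e) / 2 / fact (2 * n)"
    by (rule divide_right_mono) simp
  also have "\<dots> = (e * cycle_mean (2 * n) (\<lambda>k. f k ^ 2) + intransitive_fraction n / e) / 2"
    by (simp add: cycle_mean_def intransitive_fraction_def add_divide_distrib mult_ac)
  finally show ?thesis by simp
qed

section \<open>Asymptotics of the mean and the variance\<close>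

lemma harm_even_bounds:
  assumes "n > 0"
  shows "ln (real n) \<le> harm (2 * n)" "harm (2 * n) \<le> ln (real n) + 2" "harm (2 * n) \<ge> (1 :: real)"
proof -
  have "ln (real n) \<le> ln (real (2 * n) + 1)" using assms by simp
  then show "ln (real n) \<le> harm (2 * n)" using harm_ge_ln[of "2 * n"] by linarith
  \<comment> \<open>The sequence \<open>harm k - ln k\<close> decreases from its value 1 at
    \<open>k = 1\<close>; together with \<open>ln 2 \<le> 1\<close> this yields the constant
    2.\<close>
  have "harm (2 * n) - ln (real (2 * n)) \<le> harm 1 - ln (real 1)"
    using assms by (intro euler_mascheroni_sequence_decreasing) auto
  moreover have "ln (real (2 * n)) = ln 2 + ln (real n)" using assms by (simp add: ln_mult)
  moreover have "ln 2 \<le> (1 :: real)" using ln_le_minus_one[of 2] by simp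
  ultimately show "harm (2 * n) \<le> ln (real n) + 2" by (simp add: harm_def)
  have "harm 1 \<le> (harm (2 * n) :: real)" using assms by (intro harm_mono) auto
  then show "harm (2 * n) \<ge> (1 :: real)" by (simp add: harm_def)
qed

text \<open>The fraction is \<open>O(1 / n)\<close>, against which \<open>log n\<close> squared is
  negligible. These conditions keep the errors of the first two moments bounded; 12 is where
  \<open>6 / n\<close> falls to 1/2.\<close>

lemma intransitive_fraction_harm_square:
  "eventually (\<lambda>n. n \<ge> 12 \<and> intransitive_fraction n \<le> 1 / 2 \<and> intransitive_fraction n * harm (2 * n) ^ 2 \<le> 1) at_top"
proof -
  have "eventually (\<lambda>n::nat. 6 / real n * (ln (real n) + 2) ^ 2 \<le> 1) at_top"
    by real_asymp
  moreover have "eventually (\<lambda>n::nat. n \<ge> 12) at_top" by (rule eventually_ge_at_top)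
  ultimately show ?thesis
  proof eventually_elim
    case (elim n)
    have d: "intransitive_fraction n \<le> 6 / real n"
      using elim by (intro intransitive_fraction_le) simp
    moreover have "6 / real n \<le> 1 / 2" using elim by (simp add: field_simps)
    moreover have "intransitive_fraction n * harm (2 * n) ^ 2 \<le> 6 / real n * (ln (real n) + 2) ^ 2"
      using d harm_even_bounds[of n] elim by (intro mult_mono power_mono) auto
    ultimately show ?case using elim by linarith
  qed
qed

lemma integrable_random_rooted_map:
  fixes f :: "_ \<Rightarrow> 'a::{banach, second_countable_topology}"
  shows "integrable (measure_pmf (random_rooted_map n)) f"
  by (rule integrable_measure_pmf_finite) (simp add: random_rooted_map_uniform finite_rooted_maps)

lemma mean_verts_centred: "vertex_mean n (\<lambda>k. real k - c) = mean_verts n - c"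
  unfolding vertex_mean_def mean_verts_def
  by (subst Bochner_Integration.integral_diff) (auto intro: integrable_random_rooted_map)

text \<open>A free centre \<open>c\<close> allows \<open>harm (2 * n)\<close>, the exact mean for
  cycles, in place of the mean for maps.\<close>

lemma var_verts_eq:
  "var_verts n = vertex_mean n (\<lambda>k. (real k - c) ^ 2) - (mean_verts n - c) ^ 2"
proof -
  have "var_verts n = measure_pmf.variance (random_rooted_map n) (\<lambda>C. real (num_verts C) - c)"
    using mean_verts_centred[of n c] by (simp add: var_verts_def vertex_mean_def mean_verts_def)
  also have "\<dots> = vertex_mean n (\<lambda>k. (real k - c) ^ 2) - (vertex_mean n (\<lambda>k. real k - c)) ^ 2"
    unfolding vertex_mean_def by (intro measure_pmf.variance_eq integrable_random_rooted_map)
  finally show ?thesis by (simp only: mean_verts_centred)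
qed

lemma mean_var_near_harm:
  "eventually (\<lambda>n. \<bar>mean_verts n - harm (2 * n)\<bar> \<le> 2 \<and> \<bar>var_verts n - harm (2 * n)\<bar> \<le> 13) at_top"
  using intransitive_fraction_harm_square
proof eventually_elim
  case (elim n)
  define H :: real where "H = harm (2 * n)"
  define q where "q = intransitive_fraction n"
  have n: "n > 0" and q: "0 \<le> q" "q \<le> 1 / 2" and qH2: "q * H ^ 2 \<le> 1" and H: "H \<ge> 1"
    using elim intransitive_fraction_nonneg harm_even_bounds[of n] by (auto simp: q_def H_def)
  have "q * H \<le> q * H ^ 2" using q H by (intro mult_left_mono) (auto simp: power2_eq_square)
  then have qH: "q * H \<le> 1" using qH2 by simp
  define Y where "Y k = real k - H" for k
  define m v where "m = vertex_mean n Y" and "v = vertex_mean n (\<lambda>k. Y k ^ 2)"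
  define r1 r2 where "r1 = (\<Sum>p\<in>intransitive_perms n. Y (num_cycles {..<2 * n} p)) / fact (2 * n)"
    and "r2 = (\<Sum>p\<in>intransitive_perms n. Y (num_cycles {..<2 * n} p) ^ 2) / fact (2 * n)"
  define w where "w = cycle_mean (2 * n) (\<lambda>k. Y k ^ 2)"
  have w: "H - 2 \<le> w" "w \<le> H"
    using cycle_variance_bounds[of "2 * n"] by (simp_all add: w_def Y_def H_def)
  \<comment> \<open>Since \<open>q \<le> 1 / 2\<close>, dividing by \<open>1 - q\<close> costs a
    factor of at most 2.\<close>
  have solve: "\<bar>x\<bar> \<le> 2 * \<bar>(1 - q) * x\<bar>" for x
  proof -
    have "1 / 2 * \<bar>x\<bar> \<le> (1 - q) * \<bar>x\<bar>" using q by (intro mult_right_mono) auto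
    then show ?thesis using q by (simp add: abs_mult)
  qed
  have "(1 - q) * m = - r1"
    using vertex_mean_compare[OF n, of Y] cycle_mean_centred[of "2 * n"]
    unfolding m_def r1_def q_def Y_def H_def by simp
  \<comment> \<open>The weight \<open>1 / H\<close> balances the two parts: the variance
    \<open>w\<close> is at most \<open>H\<close>, and \<open>q * H \<le> 1\<close>.\<close>
  moreover have "\<bar>r1\<bar> \<le> (1 / H * w + q / (1 / H)) / 2"
    unfolding r1_def w_def q_def using H by (intro intransitive_sum_le) auto
  moreover have "1 / H * w \<le> 1" using w H by (simp add: field_simps)
  ultimately have m: "\<bar>m\<bar> \<le> 2" using solve[of m] qH by (simp add: mult.commute)
  have "(1 - q) * v = w - r2"
    using vertex_mean_compare[OF n, of "\<lambda>k. Y k ^ 2"] by (simp add: v_def r2_def q_def w_def)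
  then have vw: "(1 - q) * (v - w) = q * w - r2" by (simp add: algebra_simps)
  \<comment> \<open>Here the weight is \<open>1 / H ^ 2\<close>, because the fourth central moment
    has order \<open>H ^ 2\<close> and \<open>q * H ^ 2 \<le> 1\<close>.\<close>
  have r2: "\<bar>r2\<bar> \<le> (1 / H ^ 2 * cycle_mean (2 * n) (\<lambda>k. (Y k ^ 2) ^ 2) + q / (1 / H ^ 2)) / 2"
    unfolding r2_def q_def using H by (intro intransitive_sum_le) auto
  have Y4: "1 / H ^ 2 * cycle_mean (2 * n) (\<lambda>k. (Y k ^ 2) ^ 2) \<le> 4"
  proof -
    have "cycle_mean (2 * n) (\<lambda>k. (Y k ^ 2) ^ 2) \<le> 3 * H ^ 2 + H"
      using cycle_mean_fourth_power_le[of "2 * n"] by (simp add: Y_def H_def flip: power_mult)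
    moreover have "H \<le> H ^ 2" using H by (simp add: power2_eq_square)
    ultimately show ?thesis using H by (simp add: field_simps)
  qed
  have qw: "\<bar>q * w\<bar> \<le> 1"
  proof -
    have "w \<ge> 0" unfolding w_def cycle_mean_def by (intro divide_nonneg_nonneg sum_nonneg) auto
    then show ?thesis using mult_left_mono[OF w(2) q(1)] qH q by (simp add: abs_mult)
  qed
  have "q / (1 / H ^ 2) \<le> 1" using qH2 by simp
  then have "\<bar>r2\<bar> \<le> (4 + 1) / 2"
    by (intro order_trans[OF r2 divide_right_mono[OF add_mono[OF Y4]]]) auto
  then have "\<bar>q * w - r2\<bar> \<le> 7 / 2" using qw abs_triangle_ineq4[of "q * w" r2] by simp
  then have "2 * \<bar>q * w - r2\<bar> \<le> 7" by simp
  with solve[of "v - w", unfolded vw] have "\<bar>v - w\<bar> \<le> 7" by (rule order_trans)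
  \<comment> \<open>The 9 is \<open>7 + 2\<close>, with 2 from the lower bound on \<open>w\<close>.
    Subtracting \<open>m ^ 2 \<le> 4\<close> finally gives 13.\<close>
  then have v: "\<bar>v - H\<bar> \<le> 9" using w unfolding abs_le_iff by linarith
  have "m ^ 2 \<le> 2 ^ 2" using m by (metis abs_le_square_iff abs_numeral)
  then have m2: "m ^ 2 \<le> 4" "0 \<le> m ^ 2" by simp_all
  have m_eq: "m = mean_verts n - H" unfolding m_def Y_def by (rule mean_verts_centred)
  have "var_verts n = v - m ^ 2"
    using var_verts_eq[of n H] m_eq by (simp add: v_def Y_def)
  then have "\<bar>var_verts n - H\<bar> \<le> 13"
    using m2 v unfolding abs_le_iff by linarith
  then show ?case using m unfolding m_eq H_def by blast
qed

text \<open>The distance from \<open>f n\<close> to \<open>ln n\<close> is bounded, whereas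
  \<open>ln n\<close> tends to infinity.\<close>

lemma asymp_equiv_ln_if_near_harm:
  assumes "eventually (\<lambda>n. \<bar>f n - harm (2 * n)\<bar> \<le> c) at_top"
  shows "f \<sim>[at_top] (\<lambda>n. ln (real n))"
proof -
  have "eventually (\<lambda>n. norm (f n - ln (real n)) \<le> (c + 2) * norm (1 :: real)) at_top"
    using assms eventually_gt_at_top[of "0 :: nat"]
  proof eventually_elim
    case (elim n)
    then show ?case using harm_even_bounds[of n] by simp
  qed
  then have "(\<lambda>n. f n - ln (real n)) \<in> O(\<lambda>_. 1 :: real)" by (rule bigoI)
  also have "(\<lambda>_. 1 :: real) \<in> o(\<lambda>n::nat. ln (real n))" by real_asymp
  finally show ?thesis unfolding asymp_equiv_altdef .
qed

section \<open>Characteristic functions and the limit law\<close>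

lemma cycle_mean_iexp_near_exp:
  "norm (cycle_mean N (\<lambda>k. iexp x ^ k) - exp ((iexp x - 1) * of_real (harm N))) \<le> 2 * exp 2 * x ^ 2"
proof -
  define z where "z = iexp x"
  have nz: "norm z = 1" by (simp add: z_def)
  have Re: "Re z \<le> 1" "\<bar>Re (z - 1)\<bar> \<le> 2"
    using complex_Re_le_cmod[of z] abs_Re_le_cmod[of z] nz by auto
  have zx: "norm (z - 1) \<le> \<bar>x\<bar>" using iexp_approx1[of x 0] by (simp add: z_def)
  \<comment> \<open>Each factor is a convex combination of 1 and \<open>z\<close>, both of norm
    1.\<close>
  have l: "norm (1 + (z - 1) / of_nat j) \<le> 1" if "j \<in> {1..N}" for j
  proof -
    have j: "real j \<ge> 1" using that by simp
    have "1 + (z - 1) / of_nat j = of_real (1 - 1 / real j) + z / of_nat j"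
      by (simp add: diff_divide_distrib)
    also have "norm \<dots> \<le> \<bar>1 - 1 / real j\<bar> + 1 / real j"
      using norm_triangle_ineq[of "of_real (1 - 1 / real j)" "z / of_nat j"]
      by (simp only: norm_of_real norm_divide nz norm_of_nat)
    also have "\<dots> = 1" using j by simp
    finally show ?thesis .
  qed
  have r: "norm (exp ((z - 1) / of_nat j)) \<le> 1" if "j \<in> {1..N}" for j
    using Re by (simp add: Re_divide_of_nat divide_nonpos_nonneg)
  \<comment> \<open>The exponential is the characteristic function of a Poisson variable with mean
    \<open>harm N\<close>. It splits into factors that match those of
    \<open>cycle_mean_power\<close>, and as all factors have norm at most 1, the products differ by
    at most the sum of the factorwise differences.\<close>
  have "exp ((z - 1) * of_real (harm N)) = (\<Prod>j=1..N. exp ((z - 1) / of_nat j))"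
    by (simp add: harm_def sum_distrib_left divide_inverse flip: exp_sum)
  then have "norm (cycle_mean N (\<lambda>k. z ^ k) - exp ((z - 1) * of_real (harm N))) \<le>
      (\<Sum>j=1..N. norm (1 + (z - 1) / of_nat j - exp ((z - 1) / of_nat j)))"
    unfolding cycle_mean_power using l r by (simp only:) (rule norm_prod_diff)
  also have "\<dots> \<le> (\<Sum>j=1..N. exp 2 * x ^ 2 * (1 / real j ^ 2))"
  proof (rule sum_mono)
    fix j assume "j \<in> {1..N}"
    then have j: "real j \<ge> 1" by simp
    let ?y = "(z - 1) / of_nat j"
    have "norm (1 + ?y - exp ?y) \<le> exp \<bar>Re ?y\<bar> * norm ?y ^ 2"
      using Taylor_exp[of ?y 1] by (simp add: norm_minus_commute power2_eq_square)
    also have "\<dots> \<le> exp 2 * (\<bar>x\<bar> / real j) ^ 2"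
    proof (intro mult_mono power_mono)
      have "\<bar>Re ?y\<bar> \<le> \<bar>Re (z - 1)\<bar> / 1"
        using j by (simp only: Re_divide_of_nat abs_divide) (intro divide_left_mono, auto)
      then show "exp \<bar>Re ?y\<bar> \<le> exp 2" using Re by simp
      show "norm ?y \<le> \<bar>x\<bar> / real j" using zx by (simp add: norm_divide divide_right_mono)
    qed auto
    finally show "norm (1 + ?y - exp ?y) \<le> exp 2 * x ^ 2 * (1 / real j ^ 2)"
      by (simp add: power_divide)
  qed
  also have "\<dots> = exp 2 * x ^ 2 * (\<Sum>j<N. 1 / real (Suc j) ^ 2)"
    by (simp add: sum_distrib_left sum.atLeast1_atMost_eq)
  also have "\<dots> \<le> exp 2 * x ^ 2 * 2" by (intro mult_left_mono sum_inverse_squares_le) auto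
  finally show ?thesis by (simp add: z_def)
qed


lemma harm_even_at_top: "filterlim (\<lambda>n. harm (2 * n) :: real) at_top at_top"
proof (rule filterlim_at_top_mono)
  show "filterlim (\<lambda>n::nat. ln (real n)) at_top at_top" by real_asymp
  show "eventually (\<lambda>n. ln (real n) \<le> harm (2 * n)) at_top"
    using eventually_gt_at_top[of "0 :: nat"] by eventually_elim (rule harm_even_bounds)
qed

lemma var_verts_at_top: "filterlim var_verts at_top at_top"
proof (rule filterlim_at_top_mono)
  show "filterlim (\<lambda>n. - 13 + harm (2 * n) :: real) at_top at_top"
    by (rule filterlim_tendsto_add_at_top[OF tendsto_const harm_even_at_top])
  show "eventually (\<lambda>n. - 13 + harm (2 * n) \<le> var_verts n) at_top"
    using mean_var_near_harm by eventually_elim linarith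
qed

text \<open>Numerator and denominator eventually differ by at most 13 while the variance diverges.
  The true variance can therefore normalise an exponent that contains
  \<open>harm (2 * n)\<close>.\<close>

lemma harm_over_var_verts: "(\<lambda>n. harm (2 * n) / var_verts n) \<longlonglongrightarrow> 1"
proof -
  have "(\<lambda>n. (harm (2 * n) - var_verts n) / var_verts n) \<longlonglongrightarrow> 0"
  proof (rule Lim_null_comparison)
    show "(\<lambda>n. 13 / var_verts n) \<longlonglongrightarrow> 0"
      by (rule tendsto_divide_0[OF tendsto_const filterlim_at_top_imp_at_infinity[OF var_verts_at_top]])
    show "eventually (\<lambda>n. norm ((harm (2 * n) - var_verts n) / var_verts n) \<le> 13 / var_verts n) at_top"
      using mean_var_near_harm filterlim_at_top_dense[THEN iffD1, OF var_verts_at_top, rule_format, of 0]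
      by eventually_elim (auto simp: abs_divide intro!: divide_right_mono)
  qed
  then have "(\<lambda>n. (harm (2 * n) - var_verts n) / var_verts n + 1) \<longlonglongrightarrow> 0 + 1"
    by (intro tendsto_add tendsto_const)
  moreover have "eventually (\<lambda>n. (harm (2 * n) - var_verts n) / var_verts n + 1 = harm (2 * n) / var_verts n) at_top"
    using filterlim_at_top_dense[THEN iffD1, OF var_verts_at_top, rule_format, of 0]
    by eventually_elim (simp add: field_simps)
  ultimately show ?thesis by (simp add: tendsto_cong)
qed

lemma intransitive_fraction_tendsto_0: "intransitive_fraction \<longlonglongrightarrow> 0"
proof (rule Lim_null_comparison)
  show "(\<lambda>n. 6 / real n) \<longlonglongrightarrow> 0" by real_asymp
  show "eventually (\<lambda>n. norm (intransitive_fraction n) \<le> 6 / real n) at_top"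
    using eventually_ge_at_top[of "2 :: nat"]
    by eventually_elim (use intransitive_fraction_le in \<open>simp add: intransitive_fraction_nonneg\<close>)
qed

text \<open>Maps are replaced by uniform permutations and these by a Poisson law, at costs of order
  \<open>intransitive_fraction n\<close> and \<open>x n ^ 2\<close>. The Poisson exponent is then
  expanded to second order, using that \<open>x n\<close> tends to 0 and
  \<open>x n ^ 2 * H n\<close> to \<open>t ^ 2\<close>.\<close>

lemma char_tendsto:
  "(\<lambda>n. vertex_mean n (\<lambda>k. iexp (t * ((real k - mean_verts n) / sqrt (var_verts n))))) \<longlonglongrightarrow>
    of_real (exp (- (t ^ 2) / 2))"
proof -
  define x where "x n = t / sqrt (var_verts n)" for n
  define f where "f n k = iexp (t * ((real k - mean_verts n) / sqrt (var_verts n)))" for n k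
  define H :: "nat \<Rightarrow> real" where "H n = harm (2 * n)" for n
  define a where "a n = iexp (- (x n * mean_verts n))" for n
  have var_pos: "eventually (\<lambda>n. var_verts n > 0) at_top"
    using filterlim_at_top_dense[THEN iffD1, OF var_verts_at_top] by blast
  have f_eq: "f n k = a n * iexp (x n) ^ k" for n k
    by (simp add: f_def a_def x_def exp_of_nat_mult[symmetric] exp_add[symmetric] diff_divide_distrib algebra_simps)
  have x0: "x \<longlonglongrightarrow> 0"
    unfolding x_def
    by (intro tendsto_divide_0[OF tendsto_const] filterlim_at_top_imp_at_infinity
        filterlim_compose[OF sqrt_at_top var_verts_at_top])
  have "(\<lambda>n. t ^ 2 * (H n / var_verts n)) \<longlonglongrightarrow> t ^ 2 * 1"
    unfolding H_def by (intro tendsto_mult tendsto_const harm_over_var_verts)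
  moreover have "eventually (\<lambda>n. t ^ 2 * (H n / var_verts n) = x n ^ 2 * H n) at_top"
    using var_pos by eventually_elim (simp add: x_def power_divide)
  ultimately have x2H: "(\<lambda>n. x n ^ 2 * H n) \<longlonglongrightarrow> t ^ 2"
    by (simp add: tendsto_cong)
  have "(\<lambda>n. vertex_mean n (f n) - cycle_mean (2 * n) (f n)) \<longlonglongrightarrow> 0"
  proof (rule Lim_null_comparison)
    show "(\<lambda>n. 2 * intransitive_fraction n) \<longlonglongrightarrow> 0" using tendsto_mult[OF tendsto_const intransitive_fraction_tendsto_0, of 2] by simp
    show "eventually (\<lambda>n. norm (vertex_mean n (f n) - cycle_mean (2 * n) (f n)) \<le> 2 * intransitive_fraction n) at_top"
      using eventually_gt_at_top[of "0 :: nat"]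
      by eventually_elim (rule vertex_mean_bounded_compare, auto simp: f_def)
  qed
  moreover have "(\<lambda>n. cycle_mean (2 * n) (f n) - a n * exp ((iexp (x n) - 1) * of_real (H n))) \<longlonglongrightarrow> 0"
  proof (rule Lim_null_comparison)
    show "(\<lambda>n. 2 * exp 2 * x n ^ 2) \<longlonglongrightarrow> 0"
      using tendsto_mult[OF tendsto_const tendsto_power[OF x0, of 2], of "2 * exp 2"] by simp
    have "norm (cycle_mean (2 * n) (f n) - a n * exp ((iexp (x n) - 1) * of_real (H n))) \<le> 2 * exp 2 * x n ^ 2" for n
    proof -
      have "cycle_mean (2 * n) (f n) - a n * exp ((iexp (x n) - 1) * of_real (H n)) =
          a n * (cycle_mean (2 * n) (\<lambda>k. iexp (x n) ^ k) - exp ((iexp (x n) - 1) * of_real (H n)))"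
        using cycle_mean_cmult[of "2 * n" "a n" "\<lambda>k. iexp (x n) ^ k"] by (simp add: f_eq[abs_def] right_diff_distrib)
      then show ?thesis
        using cycle_mean_iexp_near_exp[of "2 * n" "x n"] by (simp add: norm_mult a_def H_def)
    qed
    then show "eventually (\<lambda>n. norm (cycle_mean (2 * n) (f n) - a n * exp ((iexp (x n) - 1) * of_real (H n))) \<le>
        2 * exp 2 * x n ^ 2) at_top" by simp
  qed
  moreover have "(\<lambda>n. a n * exp ((iexp (x n) - 1) * of_real (H n))) \<longlonglongrightarrow> of_real (exp (- (t ^ 2) / 2))"
  proof -
    \<comment> \<open>The exponent is \<open>u n + b n - x n ^ 2 * H n / 2\<close>. Here
      \<open>u n\<close> is the mismatch between \<open>H n\<close> and the true mean, which is
      bounded before scaling by \<open>x n\<close>, and \<open>b n\<close> is the Taylor remainder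
      times \<open>H n\<close>, of order \<open>x n * (x n ^ 2 * H n)\<close>.\<close>
    define u where "u n = \<i> * of_real (x n * (H n - mean_verts n))" for n
    define b where "b n = (iexp (x n) - (1 + \<i> * of_real (x n) - of_real (x n ^ 2) / 2)) * of_real (H n)" for n
    have u: "u \<longlonglongrightarrow> 0"
    proof (rule Lim_null_comparison)
      show "(\<lambda>n. \<bar>x n\<bar> * 2) \<longlonglongrightarrow> 0" using tendsto_mult[OF tendsto_rabs[OF x0] tendsto_const, of 2] by simp
      show "eventually (\<lambda>n. norm (u n) \<le> \<bar>x n\<bar> * 2) at_top"
        using mean_var_near_harm
        by eventually_elim
          (auto simp: u_def norm_mult abs_mult H_def abs_minus_commute simp del: of_real_mult of_real_diff intro!: mult_left_mono)
    qed
    have b: "b \<longlonglongrightarrow> 0"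
    proof (rule Lim_null_comparison)
      show "(\<lambda>n. \<bar>x n\<bar> / 6 * (x n ^ 2 * H n)) \<longlonglongrightarrow> 0"
        using tendsto_mult[OF tendsto_divide[OF tendsto_rabs[OF x0] tendsto_const[of 6]] x2H] by simp
      have "norm (b n) \<le> \<bar>x n\<bar> / 6 * (x n ^ 2 * H n)" for n
      proof -
        have "(\<Sum>k\<le>2. (\<i> * complex_of_real (x n)) ^ k / fact k) = 1 + \<i> * of_real (x n) - of_real (x n ^ 2) / 2"
          by (simp add: numeral_2_eq_2 mult_ac)
        moreover have "fact (Suc 2) = (6 :: real)" by (simp add: numeral_2_eq_2)
        moreover have "Suc 2 = 3" by simp
        ultimately have "norm (iexp (x n) - (1 + \<i> * of_real (x n) - of_real (x n ^ 2) / 2)) \<le> \<bar>x n\<bar> ^ 3 / 6"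
          using iexp_approx1[of "x n" 2] by metis
        then have "norm (iexp (x n) - (1 + \<i> * of_real (x n) - of_real (x n ^ 2) / 2)) * H n \<le> \<bar>x n\<bar> ^ 3 / 6 * H n"
          by (rule mult_right_mono) (simp add: H_def harm_nonneg)
        moreover have "norm (complex_of_real (H n)) = H n" by (simp add: H_def harm_nonneg)
        ultimately have "norm (b n) \<le> \<bar>x n\<bar> ^ 3 / 6 * H n" unfolding b_def norm_mult by simp
        also have "\<bar>x n\<bar> ^ 3 = \<bar>x n\<bar> * \<bar>x n\<bar> ^ 2" by (simp only: power3_eq_cube power2_eq_square mult.assoc)
        also have "\<dots> / 6 * H n = \<bar>x n\<bar> / 6 * (x n ^ 2 * H n)" by (simp only: power2_abs) simp
        finally show ?thesis .
      qed
      then show "eventually (\<lambda>n. norm (b n) \<le> \<bar>x n\<bar> / 6 * (x n ^ 2 * H n)) at_top" by simp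
    qed
    have "a n * exp ((iexp (x n) - 1) * of_real (H n)) = exp (u n + b n - of_real (x n ^ 2 * H n / 2))" for n
      unfolding a_def exp_add[symmetric] u_def b_def by (rule arg_cong[where f = exp]) (simp add: algebra_simps)
    moreover have "(\<lambda>n. exp (u n + b n - of_real (x n ^ 2 * H n / 2))) \<longlonglongrightarrow> exp (0 + 0 - of_real (t ^ 2 / 2))"
      by (intro tendsto_intros u b x2H) simp
    ultimately show ?thesis by (simp add: exp_of_real[symmetric])
  qed
  ultimately have "(\<lambda>n. (vertex_mean n (f n) - cycle_mean (2 * n) (f n)) +
      ((cycle_mean (2 * n) (f n) - a n * exp ((iexp (x n) - 1) * of_real (H n))) +
       a n * exp ((iexp (x n) - 1) * of_real (H n)))) \<longlonglongrightarrow> 0 + (0 + of_real (exp (- (t ^ 2) / 2)))"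
    by (intro tendsto_add)
  then show ?thesis by (simp add: f_def[abs_def])
qed

theorem theorem4:
  shows "mean_verts \<sim>[at_top] (\<lambda>n. ln (real n)) \<and>
    var_verts \<sim>[at_top] (\<lambda>n. ln (real n)) \<and>
    weak_conv_m
      (\<lambda>n. distr (measure_pmf (random_rooted_map n)) borel
         (\<lambda>C. (real (num_verts C) - mean_verts n) / sqrt (var_verts n)))
      std_normal_distribution"
proof (intro conjI)
  show "mean_verts \<sim>[at_top] (\<lambda>n. ln (real n))" "var_verts \<sim>[at_top] (\<lambda>n. ln (real n))"
    using mean_var_near_harm by (auto intro!: asymp_equiv_ln_if_near_harm elim: eventually_mono)
  show "weak_conv_m
      (\<lambda>n. distr (measure_pmf (random_rooted_map n)) borel
         (\<lambda>C. (real (num_verts C) - mean_verts n) / sqrt (var_verts n)))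
      std_normal_distribution"
  proof (rule levy_continuity)
    show "(\<lambda>n. char (distr (measure_pmf (random_rooted_map n)) borel
         (\<lambda>C. (real (num_verts C) - mean_verts n) / sqrt (var_verts n))) t)
      \<longlonglongrightarrow> char std_normal_distribution t" for t
    proof -
      have "char (distr (measure_pmf (random_rooted_map n)) borel
          (\<lambda>C. (real (num_verts C) - mean_verts n) / sqrt (var_verts n))) t =
        vertex_mean n (\<lambda>k. iexp (t * ((real k - mean_verts n) / sqrt (var_verts n))))" for n
        unfolding char_def vertex_mean_def by (rule integral_distr) auto
      then show ?thesis using char_tendsto[of t] by (simp only: char_std_normal_distribution)
    qed
  qed (auto intro!: real_dist_normal_dist prob_space.real_distribution_distr[OF prob_space_measure_pmf])
qed

end
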